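(* Let $V$ be a $k$-vector space of dimension $n\ge2$ and let $\mathcal C$ be a regular semisimple (resp. nil regular semisimple) conjugacy class in $\mathfrak{sl}(V_F)$ under $SL(V_F)$. Then there is a representative $N\in\mathcal C$ almost commuting with a $Q'_{SL(V)}$-action if and only if the characteristic polynomial $\mathrm{char}_{\mathcal C}(\mu)$ is a homogeneous polynomial of degree $n$ in $\mu$ and $\pi^q$ for some nonzero (resp. positive) rational number $q\in\frac1{n-1}\mathbf Z\cup\frac1n\mathbf Z$.
   Context: $k$ is an algebraically closed field, $F=k((\pi))$, $A=k[[\pi]]$, $V_F=V\otimes_kF$, $V_A=V\otimes_kA$. A regular semisimple element of $\mathfrak{sl}(V_F)$ is a trace-zero endomorphism having $n$ distinct eigenvalues in an algebraic closure of $F$. An element is nil (topologically nilpotent) if it is conjugate to some $N'\in\mathfrak{sl}(V_A)$ whose image under the projection $\mathfrak{sl}(V_A)\to\mathfrak{sl}(V)$ ($\pi\mapsto0$) is nilpotent. $k^*$ acts on $F$ by $k$-algebra automorphisms with $\lambda\cdot\pi^m=\lambda^m\pi^m$, inducing an action $N\mapsto N^\lambda$ on $\mathfrak{sl}(V_F)$. The group $Q'_{SL(V)}=PGL(V)\times k^*$ acts on $\mathfrak{sl}(V_F)$ by $(g,\lambda)\cdot N=\mathrm{Ad}(g)N^\lambda$ (and similarly on the affine flag manifolds of $SL(V_F)$). A $Q'_{SL(V)}$-action is given by an algebraic homomorphism $f:k^*\to Q'_{SL(V)}$. It almost commutes with $N$ if for some nonzero integer $s$, $f(\lambda)\cdot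 N=\lambda^sN$ for all $\lambda\in k^*$. "A homogeneous polynomial of degree $n$ in $\mu$ and $\pi^q$" means an expression $\sum_{i=0}^nc_i(\pi^q)^i\mu^{n-i}$ with $c_i\in k$ (where, as the coefficients lie in $F$, $c_i\neq0$ implies $qi\in\mathbf Z$). *)

theory Defs
  imports
    "Jordan_Normal_Form.Char_Poly"
    "HOL-Algebra.Algebraic_Closure_Type"
    "HOL-Algebra.Coset"
    "HOL-Computational_Algebra.Formal_Laurent_Series"
begin

text \<open>
  A basis of the \<open>n\<close>-dimensional space \<open>V\<close> is fixed, so that endomorphisms of \<open>V\<close>, \<open>V\<^sub>A\<close>, \<open>V\<^sub>F\<close>
  are \<open>n \<times> n\<close> matrices over \<open>k = 'a\<close>, \<open>A = 'a fps\<close>, \<open>F = 'a fls\<close>, with \<open>\<pi>\<close> the series variable.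
\<close>

section \<open>Linear groups and Lie algebras\<close>

definition GL :: "nat \<Rightarrow> 'a::field mat monoid" where
  "GL n = units_of (ring_mat TYPE('a) n ())"

definition SL :: "nat \<Rightarrow> 'a::field mat set" where
  "SL n = {g \<in> carrier_mat n n. det g = 1}"

definition mat_trace :: "'a::comm_monoid_add mat \<Rightarrow> 'a" where
  "mat_trace Y = (\<Sum>i<dim_row Y. Y $$ (i, i))"

definition sl :: "nat \<Rightarrow> 'a::comm_ring_1 mat set" where
  "sl n = {Y \<in> carrier_mat n n. mat_trace Y = 0}"

definition SL_class :: "nat \<Rightarrow> 'a::field mat \<Rightarrow> 'a mat set" where
  "SL_class n Y = {g * Y * inv\<^bsub>GL n\<^esub> g | g. g \<in> SL n}"

definition scalar_mats :: "nat \<Rightarrow> 'a::field mat set" where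
  "scalar_mats n = {c \<cdot>\<^sub>m 1\<^sub>m n | c. c \<noteq> 0}"

text \<open>Elements of \<open>PGL n\<close> are cosets, i.e. sets of proportional invertible matrices.\<close>

definition PGL :: "nat \<Rightarrow> 'a::field mat set monoid" where
  "PGL n = GL n Mod scalar_mats n"

definition Gm :: "'a::field monoid" where
  "Gm = \<lparr>carrier = {t. t \<noteq> 0}, mult = (*), one = 1\<rparr>"

definition Qprime :: "nat \<Rightarrow> ('a::field mat set \<times> 'a) monoid" where
  "Qprime n = PGL n \<times>\<times> Gm"

section \<open>Regular semisimple and nil classes\<close>

definition regular_semisimple :: "nat \<Rightarrow> 'a::field fls mat \<Rightarrow> bool" where
  "regular_semisimple n N \<longleftrightarrow> N \<in> sl n \<and>
     card {x :: 'a fls alg_closure. eigenvalue (map_mat to_ac N) x} = n"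

definition nil_elt :: "nat \<Rightarrow> 'a::field fls mat \<Rightarrow> bool" where
  "nil_elt n N \<longleftrightarrow> (\<exists>N' :: 'a fps mat. N' \<in> sl n \<and> map_mat fps_to_fls N' \<in> SL_class n N \<and>
     (\<exists>m. map_mat (\<lambda>x. fps_nth x 0) N' ^\<^sub>m m = 0\<^sub>m n n))"

definition regular_semisimple_class :: "nat \<Rightarrow> 'a::field fls mat set \<Rightarrow> bool" where
  "regular_semisimple_class n C \<longleftrightarrow> (\<exists>N. regular_semisimple n N \<and> C = SL_class n N)"

definition nil_regular_semisimple_class :: "nat \<Rightarrow> 'a::field fls mat set \<Rightarrow> bool" where
  "nil_regular_semisimple_class n C \<longleftrightarrow>
     (\<exists>N. regular_semisimple n N \<and> nil_elt n N \<and> C = SL_class n N)"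

text \<open>The common characteristic polynomial of the members of a conjugacy class.\<close>

definition class_char_poly :: "'a::comm_ring_1 mat set \<Rightarrow> 'a poly" where
  "class_char_poly C = (THE p. \<forall>N\<in>C. char_poly N = p)"

section \<open>The group \<open>Q'\<close> and its action\<close>

text \<open>The automorphism \<open>\<Sum> a\<^sub>m \<pi>\<^sup>m \<mapsto> \<Sum> t\<^sup>m a\<^sub>m \<pi>\<^sup>m\<close> of \<open>F\<close>, for \<open>t \<noteq> 0\<close>.\<close>

definition fls_rotate :: "'a::field \<Rightarrow> 'a fls \<Rightarrow> 'a fls" where
  "fls_rotate t x = Abs_fls (\<lambda>m. t powi m * fls_nth x m)"

definition Ad :: "nat \<Rightarrow> 'a::field mat \<Rightarrow> 'a fls mat \<Rightarrow> 'a fls mat" where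
  "Ad n g N = map_mat fls_const g * N * map_mat fls_const (inv\<^bsub>GL n\<^esub> g)"

text \<open>\<open>Ad\<close> does not depend on the representative \<open>g\<close> of a class in \<open>PGL n\<close>
  (lemma \<open>Qprime_act_coset\<close> below), so the image is a singleton.\<close>

definition Qprime_act :: "nat \<Rightarrow> 'a::field mat set \<times> 'a \<Rightarrow> 'a fls mat \<Rightarrow> 'a fls mat" where
  "Qprime_act n h N = the_elem ((\<lambda>g. Ad n g (map_mat (fls_rotate (snd h)) N)) ` fst h)"

text \<open>
  Algebraic homomorphisms are group homomorphisms that are morphisms of affine varieties, i.e.
  pull back regular functions to regular functions. The coordinate ring of
  \<open>GL n \<times> Gm\<close> is generated by the matrix entries, \<open>1/det\<close>, \<open>t\<close> and \<open>1/t\<close>; that of the quotient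
  \<open>PGL n \<times> Gm\<close> consists of the functions whose pullback to \<open>GL n \<times> Gm\<close> is regular; and that
  of \<open>Gm\<close> is the ring of Laurent polynomials.
\<close>

inductive_set regular_functions_GL_Gm :: "nat \<Rightarrow> ('a::field mat \<times> 'a \<Rightarrow> 'a) set" for n where
  const: "(\<lambda>_. c) \<in> regular_functions_GL_Gm n"
| entry: "i < n \<Longrightarrow> j < n \<Longrightarrow> (\<lambda>(g, t). g $$ (i, j)) \<in> regular_functions_GL_Gm n"
| inv_det: "(\<lambda>(g, t). inverse (det g)) \<in> regular_functions_GL_Gm n"
| coord: "(\<lambda>(g, t). t) \<in> regular_functions_GL_Gm n"
| inv_coord: "(\<lambda>(g, t). inverse t) \<in> regular_functions_GL_Gm n"
| add: "r \<in> regular_functions_GL_Gm n \<Longrightarrow> s \<in> regular_functions_GL_Gm n \<Longrightarrow>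
    (\<lambda>x. r x + s x) \<in> regular_functions_GL_Gm n"
| mult: "r \<in> regular_functions_GL_Gm n \<Longrightarrow> s \<in> regular_functions_GL_Gm n \<Longrightarrow>
    (\<lambda>x. r x * s x) \<in> regular_functions_GL_Gm n"

definition regular_functions_Qprime :: "nat \<Rightarrow> ('a::field mat set \<times> 'a \<Rightarrow> 'a) set" where
  "regular_functions_Qprime n = {\<phi>. \<exists>r \<in> regular_functions_GL_Gm n.
     \<forall>g \<in> carrier (GL n). \<forall>t \<in> carrier Gm. \<phi> (scalar_mats n #>\<^bsub>GL n\<^esub> g, t) = r (g, t)}"

definition regular_functions_Gm :: "('a::field \<Rightarrow> 'a) set" where
  "regular_functions_Gm =
     {\<psi>. \<exists>(p :: 'a poly) (d :: nat). \<forall>t \<in> carrier Gm. \<psi> t = poly p t / t ^ d}"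

definition algebraic_hom :: "nat \<Rightarrow> ('a::field \<Rightarrow> 'a mat set \<times> 'a) \<Rightarrow> bool" where
  "algebraic_hom n f \<longleftrightarrow> f \<in> hom Gm (Qprime n) \<and>
     (\<forall>\<phi> \<in> regular_functions_Qprime n. \<phi> \<circ> f \<in> regular_functions_Gm)"

definition almost_commutes ::
    "nat \<Rightarrow> ('a::field \<Rightarrow> 'a mat set \<times> 'a) \<Rightarrow> 'a fls mat \<Rightarrow> bool" where
  "almost_commutes n f N \<longleftrightarrow> (\<exists>s :: int. s \<noteq> 0 \<and>
     (\<forall>t \<in> carrier Gm. Qprime_act n (f t) N = fls_const (t powi s) \<cdot>\<^sub>m N))"

section \<open>Homogeneous polynomials in \<open>\<mu>\<close> and \<open>\<pi>\<^sup>q\<close>\<close>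

text \<open>The polynomial variable is \<open>\<mu>\<close>. The floor only matters where \<open>c i \<noteq> 0\<close>,
  and there the exponent is an integer.\<close>

definition homogeneous_in_pi_power :: "nat \<Rightarrow> rat \<Rightarrow> 'a::field fls poly \<Rightarrow> bool" where
  "homogeneous_in_pi_power n q p \<longleftrightarrow> (\<exists>c :: nat \<Rightarrow> 'a.
     (\<forall>i\<le>n. c i \<noteq> 0 \<longrightarrow> q * of_nat i \<in> \<int>) \<and>
     p = (\<Sum>i\<le>n. Polynomial.monom (fls_const (c i) * fls_X_intpow \<lfloor>q * of_nat i\<rfloor>) (n - i)))"

section \<open>The definitions by choice are well-defined\<close>

lemma fls_rotate_nth [simp]:
  assumes "t \<noteq> 0"
  shows "fls_nth (fls_rotate t x) m = t powi m * fls_nth x m"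
proof -
  obtain L where "\<forall>m<L. fls_nth x m = 0" by (rule fls_nth_vanishes_belowE)
  then have "\<forall>m<L. t powi m * fls_nth x m = 0" by simp
  then show ?thesis unfolding fls_rotate_def by (rule nth_Abs_fls_lower_bound)
qed

lemma carrier_GL: "g \<in> carrier (GL n) \<longleftrightarrow>
    g \<in> carrier_mat n n \<and> (\<exists>h \<in> carrier_mat n n. h * g = 1\<^sub>m n \<and> g * h = 1\<^sub>m n)"
  by (auto simp: GL_def units_of_def Units_def ring_mat_def)

lemma group_GL: "group (GL n :: 'a::field mat monoid)"
proof -
  interpret ring "ring_mat TYPE('a) n ()" by (rule ring_mat)
  show ?thesis unfolding GL_def by (rule units_group)
qed

lemma GL_inv:
  assumes "g \<in> carrier (GL n)"
  shows "inv\<^bsub>GL n\<^esub> g \<in> carrier (GL n)" "inv\<^bsub>GL n\<^esub> g \<in> carrier_mat n n"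
    "g * inv\<^bsub>GL n\<^esub> g = 1\<^sub>m n" "inv\<^bsub>GL n\<^esub> g * g = 1\<^sub>m n"
proof -
  interpret group "GL n" by (rule group_GL)
  show 1: "inv\<^bsub>GL n\<^esub> g \<in> carrier (GL n)" using assms by simp
  then show "inv\<^bsub>GL n\<^esub> g \<in> carrier_mat n n" by (simp add: carrier_GL)
  show "g * inv\<^bsub>GL n\<^esub> g = 1\<^sub>m n" using r_inv[OF assms]
    by (simp add: GL_def units_of_def ring_mat_def)
  show "inv\<^bsub>GL n\<^esub> g * g = 1\<^sub>m n" using l_inv[OF assms]
    by (simp add: GL_def units_of_def ring_mat_def)
qed

lemma SL_subset_GL: "SL n \<subseteq> carrier (GL n :: 'a::field mat monoid)"
proof
  fix g :: "'a mat" assume "g \<in> SL n"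
  then have "g \<in> Units (ring_mat TYPE('a) n ())"
    by (intro det_non_zero_imp_unit) (simp_all add: SL_def)
  then show "g \<in> carrier (GL n)" by (simp add: GL_def units_of_def)
qed

lemma class_char_poly_SL_class:
  assumes Y: "Y \<in> carrier_mat n n" and N: "N \<in> SL_class n Y"
  shows "class_char_poly (SL_class n Y) = char_poly N"
proof -
  have *: "char_poly M = char_poly Y" if "M \<in> SL_class n Y" for M
  proof -
    from that obtain g where g: "g \<in> SL n" and M: "M = g * Y * inv\<^bsub>GL n\<^esub> g"
      by (auto simp: SL_class_def)
    have gG: "g \<in> carrier (GL n)" using g SL_subset_GL by blast
    have "similar_mat M Y"
      unfolding similar_mat_def
      by (rule exI[of _ g], rule exI[of _ "inv\<^bsub>GL n\<^esub> g"], rule similar_mat_witI[of _ _ n])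
        (use GL_inv[OF gG] gG Y M in \<open>auto simp: carrier_GL\<close>)
    then show ?thesis by (rule char_poly_similar)
  qed
  show ?thesis unfolding class_char_poly_def *[OF N]
    by (rule the_equality) (use * N in auto)
qed

lemma coset_eq:
  fixes g :: "'a::field mat"
  assumes g: "g \<in> carrier_mat n n"
  shows "scalar_mats n #>\<^bsub>GL n\<^esub> g = {c \<cdot>\<^sub>m g | c. c \<noteq> 0}"
proof -
  have "c \<cdot>\<^sub>m 1\<^sub>m n * g = c \<cdot>\<^sub>m g" for c :: 'a
    using g by (metis left_mult_one_mat mult_smult_assoc_mat one_carrier_mat)
  then show ?thesis
    by (auto simp: scalar_mats_def r_coset_def GL_def units_of_def ring_mat_def)
qed

lemma GL_inv_smult:
  fixes g :: "'a::field mat"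
  assumes g: "g \<in> carrier (GL n)" and c: "c \<noteq> 0"
  shows "c \<cdot>\<^sub>m g \<in> carrier (GL n)" "inv\<^bsub>GL n\<^esub> (c \<cdot>\<^sub>m g) = inverse c \<cdot>\<^sub>m inv\<^bsub>GL n\<^esub> g"
proof -
  interpret group "GL n :: 'a mat monoid" by (rule group_GL)
  let ?h = "inv\<^bsub>GL n\<^esub> g"
  have gC: "g \<in> carrier_mat n n" using g by (simp add: carrier_GL)
  note h = GL_inv[OF g]
  have 1: "(inverse c \<cdot>\<^sub>m ?h) * (c \<cdot>\<^sub>m g) = 1\<^sub>m n" "(c \<cdot>\<^sub>m g) * (inverse c \<cdot>\<^sub>m ?h) = 1\<^sub>m n"
  proof -
    have "(inverse c \<cdot>\<^sub>m ?h) * (c \<cdot>\<^sub>m g) = inverse c \<cdot>\<^sub>m (c \<cdot>\<^sub>m (?h * g))"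
      using gC h(2) by (metis mult_smult_assoc_mat mult_smult_distrib smult_carrier_mat)
    then show "(inverse c \<cdot>\<^sub>m ?h) * (c \<cdot>\<^sub>m g) = 1\<^sub>m n"
      using h(4) c by (auto intro!: eq_matI)
    have "(c \<cdot>\<^sub>m g) * (inverse c \<cdot>\<^sub>m ?h) = c \<cdot>\<^sub>m (inverse c \<cdot>\<^sub>m (g * ?h))"
      using gC h(2) by (metis mult_smult_assoc_mat mult_smult_distrib smult_carrier_mat)
    then show "(c \<cdot>\<^sub>m g) * (inverse c \<cdot>\<^sub>m ?h) = 1\<^sub>m n"
      using h(3) c by (auto intro!: eq_matI)
  qed
  have 2: "c \<cdot>\<^sub>m g \<in> carrier_mat n n" "inverse c \<cdot>\<^sub>m ?h \<in> carrier_mat n n"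
    using gC h(2) by auto
  show cg: "c \<cdot>\<^sub>m g \<in> carrier (GL n)" using 1 2 by (auto simp: carrier_GL)
  have ch: "inverse c \<cdot>\<^sub>m ?h \<in> carrier (GL n)" using 1 2 by (auto simp: carrier_GL)
  have "(inverse c \<cdot>\<^sub>m ?h) \<otimes>\<^bsub>GL n\<^esub> (c \<cdot>\<^sub>m g) = \<one>\<^bsub>GL n\<^esub>"
    using 1(1) by (simp add: GL_def units_of_def ring_mat_def)
  then show "inv\<^bsub>GL n\<^esub> (c \<cdot>\<^sub>m g) = inverse c \<cdot>\<^sub>m ?h"
    using inv_equality cg ch by blast
qed

lemma scalar_mats_normal: "scalar_mats n \<lhd> (GL n :: 'a::field mat monoid)"
proof -
  interpret group "GL n :: 'a mat monoid" by (rule group_GL)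
  have one: "\<one>\<^bsub>GL n\<^esub> = (1\<^sub>m n :: 'a mat)" by (simp add: GL_def units_of_def ring_mat_def)
  have mult: "x \<otimes>\<^bsub>GL n\<^esub> y = x * y" for x y :: "'a mat"
    by (simp add: GL_def units_of_def ring_mat_def)
  have oneG: "(1\<^sub>m n :: 'a mat) \<in> carrier (GL n)" using one_closed one by simp
  have scal: "(c \<cdot>\<^sub>m 1\<^sub>m n) * (g :: 'a mat) = c \<cdot>\<^sub>m g" "g * (c \<cdot>\<^sub>m 1\<^sub>m n) = c \<cdot>\<^sub>m g"
    if "g \<in> carrier_mat n n" for c g
    using that by (metis left_mult_one_mat mult_smult_assoc_mat one_carrier_mat)
      (use that in \<open>metis right_mult_one_mat mult_smult_distrib one_carrier_mat\<close>)
  have "subgroup (scalar_mats n) (GL n :: 'a mat monoid)"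
  proof (rule subgroupI)
    show "scalar_mats n \<subseteq> carrier (GL n :: 'a mat monoid)"
      using GL_inv_smult(1)[OF oneG] by (auto simp: scalar_mats_def)
    have "(1 :: 'a) \<cdot>\<^sub>m 1\<^sub>m n \<in> scalar_mats n"
      unfolding scalar_mats_def by (intro CollectI exI[of _ 1]) simp
    then show "scalar_mats n \<noteq> ({} :: 'a mat set)" by blast
  next
    fix a :: "'a mat" assume "a \<in> scalar_mats n"
    then obtain c where c: "c \<noteq> 0" "a = c \<cdot>\<^sub>m 1\<^sub>m n" by (auto simp: scalar_mats_def)
    have "inv\<^bsub>GL n\<^esub> (1\<^sub>m n :: 'a mat) = 1\<^sub>m n" using inv_one one by simp
    then have "inv\<^bsub>GL n\<^esub> a = inverse c \<cdot>\<^sub>m 1\<^sub>m n" using GL_inv_smult(2)[OF oneG c(1)] c(2) by simp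
    then show "inv\<^bsub>GL n\<^esub> a \<in> scalar_mats n" using c(1) unfolding scalar_mats_def by force
  next
    fix a b :: "'a mat" assume "a \<in> scalar_mats n" "b \<in> scalar_mats n"
    then obtain c d where c: "c \<noteq> 0" "a = c \<cdot>\<^sub>m 1\<^sub>m n" and d: "d \<noteq> 0" "b = d \<cdot>\<^sub>m 1\<^sub>m n"
      by (auto simp: scalar_mats_def)
    have "a * b = (c * d) \<cdot>\<^sub>m 1\<^sub>m n" using c d scal(1)[of "d \<cdot>\<^sub>m 1\<^sub>m n" c]
      by (auto intro!: eq_matI)
    then show "a \<otimes>\<^bsub>GL n\<^esub> b \<in> scalar_mats n" using c(1) d(1) unfolding scalar_mats_def mult
      by (metis (mono_tags, lifting) mem_Collect_eq mult_eq_0_iff)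
  qed
  moreover have "x \<otimes>\<^bsub>GL n\<^esub> a \<otimes>\<^bsub>GL n\<^esub> inv\<^bsub>GL n\<^esub> x \<in> scalar_mats n"
    if x: "x \<in> carrier (GL n)" and a: "a \<in> scalar_mats n" for x a :: "'a mat"
  proof -
    obtain c where c: "c \<noteq> 0" "a = c \<cdot>\<^sub>m 1\<^sub>m n" using a by (auto simp: scalar_mats_def)
    have xC: "x \<in> carrier_mat n n" using x by (simp add: carrier_GL)
    have "x * a * inv\<^bsub>GL n\<^esub> x = c \<cdot>\<^sub>m 1\<^sub>m n"
      using scal(2)[OF xC] GL_inv[OF x] xC c(2) by (simp add: mult_smult_assoc_mat)
    then show ?thesis using a c(2) by (simp add: mult)
  qed
  ultimately show ?thesis by (simp add: normal_inv_iff)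
qed

lemma group_Qprime: "group (Qprime n :: ('a::field mat set \<times> 'a) monoid)"
proof -
  have "group (Gm :: 'a monoid)"
    by (rule groupI) (auto simp: Gm_def intro: exI[of _ "inverse x" for x])
  then show ?thesis unfolding Qprime_def PGL_def
    by (intro DirProd_group normal.factorgroup_is_group scalar_mats_normal)
qed

lemma Qprime_act_coset:
  fixes g :: "'a::field mat"
  assumes g: "g \<in> carrier (GL n)" and N: "N \<in> carrier_mat n n"
  shows "Qprime_act n (scalar_mats n #>\<^bsub>GL n\<^esub> g, t) N = Ad n g (map_mat (fls_rotate t) N)"
proof -
  have gC: "g \<in> carrier_mat n n" using g by (simp add: carrier_GL)
  note h = GL_inv(2)[OF g]
  let ?M = "map_mat (fls_rotate t) N"
  have MC: "?M \<in> carrier_mat n n" using N by simp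
  have cst: "map_mat fls_const (c \<cdot>\<^sub>m x) = fls_const c \<cdot>\<^sub>m map_mat fls_const x" for c and x :: "'a mat"
    by (auto intro!: eq_matI simp: fls_const_mult_const)
  have *: "Ad n (c \<cdot>\<^sub>m g) ?M = Ad n g ?M" if c: "c \<noteq> 0" for c
  proof -
    let ?g = "map_mat fls_const g" and ?h = "map_mat fls_const (inv\<^bsub>GL n\<^esub> g)"
    have gh: "?g \<in> carrier_mat n n" "?h \<in> carrier_mat n n" using gC h by auto
    have "Ad n (c \<cdot>\<^sub>m g) ?M = (fls_const c \<cdot>\<^sub>m ?g) * ?M * (fls_const (inverse c) \<cdot>\<^sub>m ?h)"
      by (simp add: Ad_def GL_inv_smult(2)[OF g c] cst)
    also have "\<dots> = fls_const c \<cdot>\<^sub>m (fls_const (inverse c) \<cdot>\<^sub>m (?g * ?M * ?h))"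
    proof -
      have 1: "(fls_const c \<cdot>\<^sub>m ?g) * ?M = fls_const c \<cdot>\<^sub>m (?g * ?M)"
        by (rule mult_smult_assoc_mat[OF gh(1) MC])
      have gM: "?g * ?M \<in> carrier_mat n n" using gh MC by simp
      have 2: "(fls_const c \<cdot>\<^sub>m (?g * ?M)) * (fls_const (inverse c) \<cdot>\<^sub>m ?h) =
          fls_const c \<cdot>\<^sub>m (?g * ?M * (fls_const (inverse c) \<cdot>\<^sub>m ?h))"
        by (rule mult_smult_assoc_mat[OF gM smult_carrier_mat[OF gh(2)]])
      show ?thesis unfolding 1 2 mult_smult_distrib[OF gM gh(2)] ..
    qed
    also have "\<dots> = (fls_const c * fls_const (inverse c)) \<cdot>\<^sub>m (?g * ?M * ?h)"
      by (auto intro!: eq_matI simp: mult.assoc)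
    also have "fls_const c * fls_const (inverse c) = 1"
      using c by (simp add: fls_const_mult_const)
    also have "1 \<cdot>\<^sub>m (?g * ?M * ?h) = ?g * ?M * ?h" by (auto intro!: eq_matI)
    finally show ?thesis by (simp add: Ad_def)
  qed
  have "(\<lambda>g. Ad n g ?M) ` (scalar_mats n #>\<^bsub>GL n\<^esub> g) = {Ad n g ?M}"
  proof -
    have "1 \<cdot>\<^sub>m g \<in> {c \<cdot>\<^sub>m g | c. c \<noteq> 0}" by (intro CollectI exI[of _ 1]) simp
    then have "{c \<cdot>\<^sub>m g | c. c \<noteq> 0} \<noteq> {}" by blast
    then show ?thesis unfolding coset_eq[OF gC] using * by (auto simp: image_def)
  qed
  then show ?thesis by (simp add: Qprime_act_def)
qed

end

theory Submission
  imports Defs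
begin

text \<open>
  If \<open>N\<close> almost commutes with \<open>t \<mapsto> (g\<^sub>t, t\<^sup>r)\<close> with weight \<open>s\<close>, the coefficient \<open>p\<^sub>i\<close> of \<open>\<mu>\<^sup>n\<^sup>-\<^sup>i\<close> in its
  characteristic polynomial satisfies \<open>p\<^sub>i(t\<^sup>r \<pi>) = t\<^sup>s\<^sup>i p\<^sub>i(\<pi>)\<close>, so it is a multiple of \<open>\<pi>\<^sup>q\<^sup>i\<close> for \<open>q = s/r\<close>.
  As the roots are distinct, \<open>p\<^sub>n \<noteq> 0\<close> or \<open>p\<^sub>n\<^sub>-\<^sub>1 \<noteq> 0\<close>, which bounds the denominator of \<open>q\<close>.

  Conversely, with \<open>q = a/b\<close> in lowest terms the characteristic polynomial is
  \<open>\<mu>\<^sup>e \<Prod> (\<mu>\<^sup>b - \<alpha>\<^sub>k \<pi>\<^sup>a)\<close> with \<open>e \<le> 1\<close>, which is also that of an explicit block matrix with monomial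
  entries, homogeneous for a diagonal one-parameter group. A Krylov basis argument conjugates \<open>N\<close> to it
  over \<open>GL\<^sub>n(F)\<close>. The determinant of the conjugating matrix is corrected by a diagonal matrix \<open>h\<close> which
  is a product of a matrix of monomials and one that commutes with the block matrix: for \<open>e = 1\<close> the last
  entry is free, and for \<open>e = 0\<close> the characteristic does not divide \<open>b\<close>, so every element
  of \<open>F\<^sup>*\<close> is a monomial times a \<open>b\<close>-th power, the determinant of a scalar matrix on the first block.
\<close>

section \<open>Matrices with the same distinct eigenvalues\<close>

text \<open>If the field were finite, the product of all \<open>X - x\<close>, increased by 1, would
  take the value 1 everywhere and so be a nonconstant polynomial without a root.\<close>

lemma infinite_UNIV_alg_closed: "infinite (UNIV :: 'a::alg_closed_field set)"
proof
  assume fin: "finite (UNIV :: 'a set)"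
  define p :: "'a poly" where "p = (\<Prod>x\<in>UNIV. [:-x, 1:])"
  have deg: "Polynomial.degree p = card (UNIV :: 'a set)"
    unfolding p_def by (subst degree_prod_eq_sum_degree) auto
  have pos: "card (UNIV :: 'a set) > 0" using fin by (simp add: finite_UNIV_card_ge_0)
  then have "Polynomial.degree (p + 1) = Polynomial.degree p" using deg by (intro degree_add_eq_left) simp
  then obtain x where "poly (p + 1) x = 0"
    using alg_closed_imp_poly_has_root[of "p + 1"] deg pos by auto
  moreover have "poly p x = 0"
    unfolding p_def poly_prod using fin by (intro prod_zero) (auto intro!: bexI[of _ x])
  ultimately show False by simp
qed

lemma infinite_UNIV_fls: "infinite (UNIV :: 'a::field fls set)"
proof -
  have "inj (\<lambda>i. fls_X_intpow (int i) :: 'a fls)"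
  proof (rule injI)
    fix i j assume "fls_X_intpow (int i) = (fls_X_intpow (int j) :: 'a fls)"
    then have "fls_subdegree (fls_X_intpow (int i) :: 'a fls) = fls_subdegree (fls_X_intpow (int j) :: 'a fls)"
      by (rule arg_cong)
    then show "i = j" by simp
  qed
  then show ?thesis using infinite_iff_countable_subset by blast
qed

section \<open>Cyclic vectors and companion matrices\<close>

interpretation to_ac: field_hom "to_ac :: 'a::field \<Rightarrow> 'a alg_closure"
  by unfold_locales auto

lemma poly_eq_0_if_card_roots:
  fixes p :: "'a::idom poly"
  assumes "\<And>x. x \<in> S \<Longrightarrow> poly p x = 0" "Polynomial.degree p < card S"
  shows "p = 0"
  using assms poly_roots_degree[of p]
  by (metis (mono_tags, lifting) card_mono leD le_trans mem_Collect_eq poly_roots_finite subsetI)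

text \<open>The Vandermonde argument in polynomial form. It serves twice: for the independence of
  the Krylov vectors and for the uniqueness of the companion coefficients.\<close>

lemma coeffs_eq_0_if_card_roots:
  fixes c :: "nat \<Rightarrow> 'a::idom"
  assumes "\<And>x. x \<in> S \<Longrightarrow> (\<Sum>k<n. c k * x ^ k) = 0" "card S \<ge> n" "k < n"
  shows "c k = 0"
proof -
  let ?p = "\<Sum>k<n. Polynomial.monom (c k) k"
  have "?p = 0"
  proof (rule poly_eq_0_if_card_roots)
    show "poly ?p x = 0" if "x \<in> S" for x using assms(1)[OF that] by (simp add: poly_sum poly_monom)
    have "Polynomial.degree ?p \<le> n - 1"
      by (rule degree_sum_le) (auto intro: order.trans[OF degree_monom_le])
    then show "Polynomial.degree ?p < card S" using assms(2,3) by simp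
  qed
  moreover have "Polynomial.coeff ?p k = c k" using assms(3) by (simp add: coeff_sum)
  ultimately show ?thesis by simp
qed

text \<open>A left eigenvector is an eigenvector of the transpose, which has the same characteristic
  polynomial.\<close>

lemma left_eigenvector:
  fixes A :: "'a::field mat"
  assumes A: "A \<in> carrier_mat n n" and x: "eigenvalue A x"
  obtains y where "\<forall>j<n. (\<Sum>i<n. y i * A $$ (i,j)) = x * y j" "\<exists>i<n. y i \<noteq> 0"
proof -
  have "eigenvalue A\<^sup>T x"
    using x A by (simp add: eigenvalue_root_char_poly[of _ n])
  then obtain v where v: "v \<in> carrier_vec n" "v \<noteq> 0\<^sub>v n" "A\<^sup>T *\<^sub>v v = x \<cdot>\<^sub>v v"
    using A by (auto simp: eigenvalue_def eigenvector_def)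
  show ?thesis
  proof (rule that, intro allI impI)
    fix j assume j: "j < n"
    have "(A\<^sup>T *\<^sub>v v) $ j = (\<Sum>i<n. v $ i * A $$ (i,j))"
      using j A v(1) by (auto simp: scalar_prod_def lessThan_atLeast0 mult.commute intro!: sum.cong)
    then show "(\<Sum>i<n. v $ i * A $$ (i,j)) = x * v $ j" using v(1,3) j by simp
  next
    show "\<exists>i<n. v $ i \<noteq> 0" using v(1,2) by (metis eq_vecI carrier_vecD index_zero_vec)
  qed
qed

text \<open>Eigenvectors live over the algebraic closure, but the cyclic vector has to have
  coordinates in the base field. Finitely many nonzero functionals exclude only finitely many values
  of a parameter in that infinite field.\<close>

lemma avoid_functionals:
  fixes y :: "'b \<Rightarrow> nat \<Rightarrow> 'a::field alg_closure"
  assumes inf: "infinite (UNIV :: 'a set)" and fin: "finite E"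
    and nz: "\<forall>x\<in>E. \<exists>i<n. y x i \<noteq> 0"
  obtains v :: "nat \<Rightarrow> 'a" where "\<forall>x\<in>E. (\<Sum>i<n. y x i * to_ac (v i)) \<noteq> 0"
proof -
  let ?p = "\<lambda>x. \<Sum>i<n. Polynomial.monom (y x i) i"
  have "?p x \<noteq> 0" if x: "x \<in> E" for x
  proof -
    obtain i where "i < n" "y x i \<noteq> 0" using nz x by auto
    then have "Polynomial.coeff (?p x) i \<noteq> 0" by (simp add: coeff_sum)
    then show ?thesis by force
  qed
  then have "finite (\<Union>x\<in>E. {t. poly (?p x) t = 0})" using fin by (auto intro: poly_roots_finite)
  moreover have "infinite (range (to_ac :: 'a \<Rightarrow> _))"
    using inf inj_to_ac finite_imageD by blast
  \<comment> \<open>\<open>v = (1, t, t\<^sup>2, \<dots>)\<close> turns each functional into a nonzero polynomial in \<open>t\<close>.\<close>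
  ultimately obtain t :: 'a where "to_ac t \<notin> (\<Union>x\<in>E. {t. poly (?p x) t = 0})"
    by (meson finite_subset image_subsetI)
  then show ?thesis
    by (intro that[of "\<lambda>i. t ^ i"]) (auto simp: poly_sum poly_monom)
qed

text \<open>The matrix of multiplication by X modulo
  \<open>X^n - (z 0 + ... + z (n-1) X^(n-1))\<close> in the basis 1, X, ..., \<open>X^(n-1)\<close>;
  the relation sits in the last column, without signs.\<close>

definition companion_mat :: "nat \<Rightarrow> (nat \<Rightarrow> 'a::zero_neq_one) \<Rightarrow> 'a mat" where
  "companion_mat n z =
     mat n n (\<lambda>(i, j). if Suc j < n then (if i = Suc j then 1 else 0) else z i)"

text \<open>A vector \<open>v\<close> that no left eigenvector annihilates is cyclic when the n
  eigenvalues are distinct, so v, Nv, ..., \<open>N^(n-1) v\<close> are the columns of an invertible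
  \<open>P\<close>. Writing \<open>N^n v\<close> in this basis gives \<open>z\<close>, and pairing
  that relation with the left eigenvectors shows that every eigenvalue satisfies it.\<close>

lemma rational_form:
  fixes N :: "'a::field mat"
  assumes inf: "infinite (UNIV :: 'a set)" and N: "N \<in> carrier_mat n n"
    and E: "E = {x. eigenvalue (map_mat to_ac N) x}" and card: "card E = n"
  obtains P z where "P \<in> carrier_mat n n" "det P \<noteq> 0" "N * P = P * companion_mat n z"
    "\<forall>x\<in>E. x ^ n = (\<Sum>i<n. to_ac (z i) * x ^ i)"
proof (cases "n = 0")
  \<comment> \<open>For n = 0 the equation \<open>card E = n\<close> alone would not exclude an
    infinite \<open>E\<close>, since infinite sets have cardinality 0.\<close>
  case True
  have "E = {}"
    unfolding E using N True eigenvalue_imp_nonzero_dim[of "map_mat to_ac N" 0] by auto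
  then show ?thesis using N True
    by (intro that[of "1\<^sub>m 0" "\<lambda>_. 0"]) (auto simp: companion_mat_def)
next
  case False
  then have "finite E" using card card.infinite by fastforce
  have "\<exists>y. (\<forall>j<n. (\<Sum>i<n. y i * to_ac (N $$ (i,j))) = x * y j) \<and> (\<exists>i<n. y i \<noteq> 0)" if x: "x \<in> E" for x
  proof -
    have "map_mat to_ac N \<in> carrier_mat n n" "eigenvalue (map_mat to_ac N) x" using N x E by auto
    then obtain y where "\<forall>j<n. (\<Sum>i<n. y i * map_mat to_ac N $$ (i,j)) = x * y j" "\<exists>i<n. y i \<noteq> 0"
      by (rule left_eigenvector)
    then show ?thesis using N by (intro exI[of _ y]) auto
  qed
  then obtain y where y: "\<And>x j. x \<in> E \<Longrightarrow> j < n \<Longrightarrow> (\<Sum>i<n. y x i * to_ac (N $$ (i,j))) = x * y x j"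
    and nz: "\<forall>x\<in>E. \<exists>i<n. y x i \<noteq> 0" by metis
  obtain v :: "nat \<Rightarrow> 'a" where v: "\<forall>x\<in>E. (\<Sum>i<n. y x i * to_ac (v i)) \<noteq> 0"
    by (rule avoid_functionals[OF inf \<open>finite E\<close> nz])
  \<comment> \<open>\<open>w k\<close> is the coordinate function of \<open>N^k v\<close>.\<close>
  define w where "w = rec_nat v (\<lambda>_ u i. \<Sum>j<n. N $$ (i,j) * u j)"
  have w0: "w 0 = v" and wS: "w (Suc k) i = (\<Sum>j<n. N $$ (i,j) * w k j)" for k i
    by (simp_all add: w_def)
  have yw: "(\<Sum>i<n. y x i * to_ac (w k i)) = x ^ k * (\<Sum>i<n. y x i * to_ac (v i))" if "x \<in> E" for x k
  proof (induction k)
    case (Suc k)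
    have "(\<Sum>i<n. y x i * to_ac (w (Suc k) i)) = (\<Sum>j<n. (\<Sum>i<n. y x i * to_ac (N $$ (i,j))) * to_ac (w k j))"
      unfolding wS to_ac_sum to_ac_mult sum_distrib_left sum_distrib_right
      by (subst sum.swap) (simp add: mult.assoc)
    also have "\<dots> = x * (\<Sum>j<n. y x j * to_ac (w k j))"
      using y[OF that] by (simp add: sum_distrib_left mult.assoc)
    finally show ?case using Suc by simp
  qed (simp add: w0)
  define P where "P = mat n n (\<lambda>(i, k). w k i)"
  have P: "P \<in> carrier_mat n n" by (simp add: P_def)
  have Pc: "(P *\<^sub>v c) $ i = (\<Sum>k<n. w k i * c $ k)" if "c \<in> carrier_vec n" "i < n" for c i
    using that by (simp add: P_def scalar_prod_def lessThan_atLeast0)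
  \<comment> \<open>Pairing a combination of Krylov vectors with the left eigenvector for x
    evaluates its coefficient polynomial at x, up to the nonzero pairing with \<open>v\<close>.
    Hence a kernel vector of \<open>P\<close> is a polynomial of degree below n with n
    roots.\<close>
  have yPc: "(\<Sum>i<n. y x i * to_ac ((P *\<^sub>v c) $ i)) = (\<Sum>k<n. to_ac (c $ k) * x ^ k) * (\<Sum>i<n. y x i * to_ac (v i))"
    if "x \<in> E" "c \<in> carrier_vec n" for x c
  proof -
    have "(\<Sum>i<n. y x i * to_ac ((P *\<^sub>v c) $ i)) = (\<Sum>i<n. \<Sum>k<n. y x i * to_ac (w k i) * to_ac (c $ k))"
      by (intro sum.cong refl) (simp add: Pc that to_ac_sum sum_distrib_left mult.assoc)
    also have "\<dots> = (\<Sum>k<n. (\<Sum>i<n. y x i * to_ac (w k i)) * to_ac (c $ k))"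
      by (subst sum.swap) (simp add: sum_distrib_right)
    also have "\<dots> = (\<Sum>k<n. to_ac (c $ k) * x ^ k) * (\<Sum>i<n. y x i * to_ac (v i))"
      unfolding yw[OF that(1)] by (subst sum_distrib_right) (simp add: mult_ac)
    finally show ?thesis .
  qed
  have detP: "det P \<noteq> 0"
  proof
    assume "det P = 0"
    then obtain c where c: "c \<in> carrier_vec n" "c \<noteq> 0\<^sub>v n" "P *\<^sub>v c = 0\<^sub>v n"
      using det_0_iff_vec_prod_zero_field[OF P] by blast
    have "(\<Sum>k<n. to_ac (c $ k) * x ^ k) = 0" if "x \<in> E" for x
      using yPc[OF that c(1)] bspec[OF v that] by (simp add: c(3))
    then have "to_ac (c $ k) = 0" if "k < n" for k
      using coeffs_eq_0_if_card_roots[of E "\<lambda>k. to_ac (c $ k)" n] card that by simp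
    then have "c = 0\<^sub>v n" using c(1) by (intro eq_vecI) auto
    then show False using c(2) by simp
  qed
  have "P \<in> Units (ring_mat TYPE('a) n ())" by (rule det_non_zero_imp_unit[OF P detP])
  then obtain Q where Q: "Q \<in> carrier_mat n n" "P * Q = 1\<^sub>m n"
    by (auto simp: Units_def ring_mat_def)
  \<comment> \<open>The coordinates of \<open>N^n v\<close> in the Krylov basis, which form the last
    column of the companion matrix.\<close>
  define c where "c = Q *\<^sub>v vec n (w n)"
  have c: "c \<in> carrier_vec n" using Q(1) by (simp add: c_def)
  have PC: "P *\<^sub>v c = vec n (w n)"
    unfolding c_def using assoc_mult_mat_vec[OF P Q(1), of "vec n (w n)"] Q(2) by simp
  show ?thesis
  proof (rule that[OF P detP, of "\<lambda>i. c $ i"])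
    show "N * P = P * companion_mat n (\<lambda>i. c $ i)"
    proof (rule eq_matI)
      fix i j assume "i < dim_row (P * companion_mat n (($) c))" "j < dim_col (P * companion_mat n (($) c))"
      then have ij: "i < n" "j < n" using P by (auto simp: companion_mat_def)
      have l: "(N * P) $$ (i, j) = w (Suc j) i"
        using ij N P by (simp add: scalar_prod_def lessThan_atLeast0 wS P_def)
      have r: "(P * companion_mat n (($) c)) $$ (i, j) = (\<Sum>k<n. w k i * companion_mat n (($) c) $$ (k, j))"
        using ij P by (simp add: scalar_prod_def lessThan_atLeast0 companion_mat_def P_def)
      show "(N * P) $$ (i, j) = (P * companion_mat n (($) c)) $$ (i, j)"
      proof (cases "Suc j < n")
        case True
        have "(\<Sum>k<n. w k i * companion_mat n (($) c) $$ (k, j)) = (\<Sum>k<n. if k = Suc j then w k i else 0)"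
          using True by (intro sum.cong) (auto simp: companion_mat_def)
        also have "\<dots> = w (Suc j) i" using True by simp
        finally show ?thesis using l r by simp
      next
        case False
        then have "Suc j = n" using ij by simp
        moreover have "(\<Sum>k<n. w k i * companion_mat n (($) c) $$ (k, j)) = (P *\<^sub>v c) $ i"
          unfolding Pc[OF c ij(1)] using ij False by (intro sum.cong) (auto simp: companion_mat_def)
        ultimately show ?thesis using l r PC ij by simp
      qed
    qed (use N P in \<open>auto simp: companion_mat_def\<close>)
  next
    show "\<forall>x\<in>E. x ^ n = (\<Sum>i<n. to_ac (c $ i) * x ^ i)"
    proof
    fix x assume x: "x \<in> E"
    have "x ^ n * (\<Sum>i<n. y x i * to_ac (v i)) = (\<Sum>i<n. y x i * to_ac ((P *\<^sub>v c) $ i))"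
      unfolding PC yw[OF x, symmetric] by simp
    also note yPc[OF x c]
    finally show "x ^ n = (\<Sum>i<n. to_ac (c $ i) * x ^ i)" using bspec[OF v x] by simp
    qed
  qed
qed

text \<open>Both matrices are conjugate to companion matrices. The coefficients of these agree, as
  their difference is a polynomial of degree below n vanishing at the n common eigenvalues.\<close>

lemma conjugate_if_same_eigenvalues:
  fixes N N' :: "'a::field mat"
  assumes inf: "infinite (UNIV :: 'a set)"
    and N: "N \<in> carrier_mat n n" and N': "N' \<in> carrier_mat n n"
    and same: "{x. eigenvalue (map_mat to_ac N) x} = {x. eigenvalue (map_mat to_ac N') x}"
    and card: "card {x. eigenvalue (map_mat to_ac N) x} = n"
  obtains g where "g \<in> carrier_mat n n" "det g \<noteq> 0" "N * g = g * N'"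
proof -
  let ?E = "{x. eigenvalue (map_mat to_ac N) x}"
  obtain P z where P: "P \<in> carrier_mat n n" "det P \<noteq> 0" "N * P = P * companion_mat n z"
    and z: "\<forall>x\<in>?E. x ^ n = (\<Sum>i<n. to_ac (z i) * x ^ i)"
    by (rule rational_form[OF inf N refl card])
  obtain P' z' where P': "P' \<in> carrier_mat n n" "det P' \<noteq> 0" "N' * P' = P' * companion_mat n z'"
    and z': "\<forall>x\<in>?E. x ^ n = (\<Sum>i<n. to_ac (z' i) * x ^ i)"
    by (rule rational_form[OF inf N' same card])
  have "to_ac (z i) - to_ac (z' i) = 0" if "i < n" for i
    by (rule coeffs_eq_0_if_card_roots[of ?E "\<lambda>i. to_ac (z i) - to_ac (z' i)" n])
      (use z z' card that in \<open>auto simp: sum_subtractf left_diff_distrib\<close>)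
  then have C: "companion_mat n z' = companion_mat n z"
    by (auto simp: companion_mat_def intro!: eq_matI)
  have Cc: "companion_mat n z \<in> carrier_mat n n" by (simp add: companion_mat_def)
  have "P' \<in> Units (ring_mat TYPE('a) n ())" by (rule det_non_zero_imp_unit[OF P'(1,2)])
  then obtain Q where Q: "Q \<in> carrier_mat n n" "P' * Q = 1\<^sub>m n" "Q * P' = 1\<^sub>m n"
    by (auto simp: Units_def ring_mat_def)
  show ?thesis
  proof
    show "P * Q \<in> carrier_mat n n" using P(1) Q(1) by simp
    have "det P' * det Q = 1" using det_mult[OF P'(1) Q(1)] Q(2) by simp
    then show "det (P * Q) \<noteq> 0" using det_mult[OF P(1) Q(1)] P(2) by auto
    have "P * Q * N' = P * Q * N' * (P' * Q)" using P(1) Q(1,2) N' by simp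
    also have "\<dots> = P * Q * (N' * P') * Q"
      using P(1) Q(1) N' P'(1) by (simp add: assoc_mult_mat[of _ n n _ n _ n])
    also have "\<dots> = P * (Q * P') * companion_mat n z * Q"
      using P(1) Q(1) Cc P'(1) by (simp add: P'(3) C assoc_mult_mat[of _ n n _ n _ n])
    also have "\<dots> = N * (P * Q)"
      using P(1) Q(1,3) N Cc by (simp add: P(3)[symmetric] assoc_mult_mat[of _ n n _ n _ n])
    finally show "N * (P * Q) = P * Q * N'" by simp
  qed
qed

section \<open>Monomials and roots of Laurent series\<close>

definition fls_monom :: "'a::field \<Rightarrow> int \<Rightarrow> 'a fls" where
  "fls_monom c m = fls_const c * fls_X_intpow m"

lemma fls_monom_nth [simp]: "fls_nth (fls_monom c m) i = (if i = m then c else 0)"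
  by (auto simp: fls_monom_def fls_X_intpow_times_conv_shift)

lemma fls_monom_eq_0_iff [simp]: "fls_monom c m = 0 \<longleftrightarrow> c = 0"
  by (auto simp: fls_eq_iff)

lemma fls_monom_0_left [simp]: "fls_monom 0 m = 0"
  by simp

lemma fls_monom_0_right: "fls_monom c 0 = fls_const c"
  by (auto simp: fls_eq_iff)

lemma fls_monom_mult: "fls_monom c m * fls_monom c' m' = fls_monom (c * c') (m + m')"
proof -
  have "fls_monom c m * fls_monom c' m' =
      (fls_const c * fls_const c') * (fls_X_intpow m * fls_X_intpow m')"
    by (simp only: fls_monom_def mult_ac)
  then show ?thesis
    by (simp only: fls_const_mult_const fls_X_intpow_times_fls_X_intpow fls_monom_def)
qed

lemma fls_monom_1_0: "fls_monom 1 0 = 1"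
  by (simp add: fls_monom_0_right)

lemma fls_monom_power: "fls_monom c m ^ k = fls_monom (c ^ k) (int k * m)"
  by (induction k) (simp_all add: fls_monom_1_0 fls_monom_mult algebra_simps)

lemma inverse_fls_monom: "c \<noteq> 0 \<Longrightarrow> inverse (fls_monom c m) = fls_monom (inverse c) (- m)"
  by (rule inverse_unique) (simp add: fls_monom_mult fls_monom_1_0)

lemma fls_rotate_monom: "t \<noteq> 0 \<Longrightarrow> fls_rotate t (fls_monom c m) = fls_monom (t powi m * c) m"
  by (auto simp: fls_eq_iff)

lemma fls_subdegree_rotate:
  assumes "t \<noteq> 0"
  shows "fls_subdegree (fls_rotate t x) = fls_subdegree x"
proof (cases "x = 0")
  case True
  then have "fls_rotate t x = 0" using assms by (simp add: fls_eq_iff)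
  then show ?thesis using True by simp
next
  case False
  then show ?thesis using assms by (intro fls_subdegree_eqI) auto
qed

lemma fls_rotate_mult:
  assumes t: "t \<noteq> 0"
  shows "fls_rotate t (x * y) = fls_rotate t x * fls_rotate t y"
proof (rule fls_eqI)
  fix m
  have *: "t powi m * (fls_nth x i * fls_nth y (m - i)) =
      (t powi i * fls_nth x i) * (t powi (m - i) * fls_nth y (m - i))" for i
  proof -
    have eq: "t powi m = t powi i * t powi (m - i)"
      using t power_int_add[of t i "m - i"] by simp
    show ?thesis unfolding eq by (simp only: mult_ac)
  qed
  \<comment> \<open>Rotation preserves subdegrees, so the two convolution sums have the same finite
    range and can be compared term by term.\<close>
  show "fls_nth (fls_rotate t (x * y)) m = fls_nth (fls_rotate t x * fls_rotate t y) m"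
    unfolding fls_rotate_nth[OF t] fls_times_nth(2) fls_subdegree_rotate[OF t] sum_distrib_left
    by (intro sum.cong refl *)
qed

lemma comm_ring_hom_fls_rotate: "t \<noteq> 0 \<Longrightarrow> comm_ring_hom (fls_rotate t)"
  by unfold_locales (simp_all add: fls_rotate_mult fls_eq_iff algebra_simps)

section \<open>Roots of principal units\<close>

lemma fps_one_plus_X_power_nth:
  "fps_nth ((1 + fps_X) ^ b) 0 = (1 :: 'a::field)" "fps_nth ((1 + fps_X) ^ b) 1 = (of_nat b :: 'a)"
  by (induction b) (simp_all add: fps_mult_nth_1)

text \<open>The series \<open>(1 + X)^b - 1\<close> has no constant term and linear coefficient b,
  hence a compositional inverse when b is nonzero in the field. Substituting \<open>u - 1\<close>
  into that inverse gives the root minus 1.\<close>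

lemma fps_root_exists:
  fixes u :: "'a::field fps"
  assumes b: "of_nat b \<noteq> (0 :: 'a)" and u: "fps_nth u 0 = 1"
  obtains v where "u = v ^ b"
proof
  let ?r = "(1 + fps_X) ^ b - 1 :: 'a fps"
  let ?x = "fps_inv ?r oo (u - 1)"
  have r: "fps_nth ?r 0 = 0" "fps_nth ?r 1 \<noteq> 0"
    using b fps_one_plus_X_power_nth[of b, where ?'a = 'a] by simp_all
  have i0: "fps_nth (fps_inv ?r) 0 = 0" by (simp add: fps_inv_def)
  then have x0: "fps_nth ?x 0 = 0" by simp
  have "?r oo ?x = (?r oo fps_inv ?r) oo (u - 1)"
    by (rule fps_compose_assoc) (use u i0 in auto)
  also have "\<dots> = u - 1" using fps_inv_right[OF r] u by simp
  finally have "?r oo ?x = u - 1" .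
  moreover have "?r oo ?x = (1 + ?x) ^ b - 1"
    using x0 by (simp only: fps_compose_sub_distrib fps_compose_power[symmetric]
        fps_compose_add_distrib fps_compose_1) simp
  ultimately show "u = (1 + ?x) ^ b" by simp
qed

text \<open>Split off the leading term of \<open>d\<close>; what remains is a principal unit, which
  has a b-th root. The leading coefficient stays in the monomial, so no root of a constant is
  taken.\<close>

lemma fls_monom_times_power_decomposition:
  fixes d :: "'a::field fls"
  assumes b: "of_nat b \<noteq> (0 :: 'a)" and d: "d \<noteq> 0"
  obtains c m v where "c \<noteq> 0" "v \<noteq> 0" "d = fls_monom c m * v ^ b"
proof -
  let ?u = "fls_base_factor_to_fps d"
  define c where "c = fps_nth ?u 0"
  define m where "m = fls_subdegree d"
  have c: "c \<noteq> 0" unfolding c_def using d by (rule fls_base_factor_to_fps_base)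
  obtain v where v: "fps_const (inverse c) * ?u = v ^ b"
    using fps_root_exists[OF b, of "fps_const (inverse c) * ?u"] c c_def by auto
  have b0: "b \<noteq> 0" using b by (metis of_nat_0)
  have "fps_const c * v ^ b = (fps_const c * fps_const (inverse c)) * ?u"
    by (simp only: v[symmetric] mult.assoc)
  also have "fps_const c * fps_const (inverse c) = 1" using c by simp
  finally have "?u = fps_const c * v ^ b" by simp
  then have "fps_to_fls ?u = fps_to_fls (fps_const c) * fps_to_fls v ^ b"
    by (metis fps_to_fls_power fls_times_fps_to_fls)
  moreover have "fps_to_fls (fps_const c) = fls_const c" by (auto simp: fls_eq_iff)
  ultimately have bf: "fls_base_factor d = fls_const c * fps_to_fls v ^ b"
    by (simp only: fps_to_fls_base_factor_to_fps)
  have "d = fls_X_intpow m * fls_base_factor d"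
    unfolding m_def by (rule fls_base_factor_X_power_decompose(2))
  also have "\<dots> = fls_monom c m * fps_to_fls v ^ b"
    unfolding bf fls_monom_def by (simp only: mult_ac)
  finally have eq: "d = fls_monom c m * fps_to_fls v ^ b" .
  then have "fps_to_fls v \<noteq> 0" using d b0 by fastforce
  then show ?thesis using c eq that by blast
qed

section \<open>Diagonal one-parameter groups\<close>

lemma regular_functions_GmI:
  "(\<And>t. t \<noteq> 0 \<Longrightarrow> f t = poly p t / t ^ d) \<Longrightarrow> f \<in> regular_functions_Gm"
  by (auto simp: regular_functions_Gm_def Gm_def)

lemma regular_functions_GmE:
  assumes "f \<in> regular_functions_Gm"
  obtains p d where "\<forall>t. t \<noteq> 0 \<longrightarrow> f t = poly p t / t ^ d"
  using assms by (auto simp: regular_functions_Gm_def Gm_def)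

lemma regular_functions_Gm_const: "(\<lambda>_. c) \<in> regular_functions_Gm"
  by (rule regular_functions_GmI[of _ "[:c:]" 0]) simp

lemma regular_functions_Gm_add:
  assumes "f \<in> regular_functions_Gm" "g \<in> regular_functions_Gm"
  shows "(\<lambda>t. f t + g t) \<in> regular_functions_Gm"
proof -
  obtain p d where f: "\<forall>t. t \<noteq> 0 \<longrightarrow> f t = poly p t / t ^ d" using assms(1) by (rule regular_functions_GmE)
  obtain q e where g: "\<forall>t. t \<noteq> 0 \<longrightarrow> g t = poly q t / t ^ e" using assms(2) by (rule regular_functions_GmE)
  show ?thesis
    by (rule regular_functions_GmI[of _ "p * Polynomial.monom 1 e + q * Polynomial.monom 1 d" "d + e"])
      (auto simp: f g poly_monom field_simps power_add)
qed

lemma regular_functions_Gm_mult: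
  assumes "f \<in> regular_functions_Gm" "g \<in> regular_functions_Gm"
  shows "(\<lambda>t. f t * g t) \<in> regular_functions_Gm"
proof -
  obtain p d where f: "\<forall>t. t \<noteq> 0 \<longrightarrow> f t = poly p t / t ^ d" using assms(1) by (rule regular_functions_GmE)
  obtain q e where g: "\<forall>t. t \<noteq> 0 \<longrightarrow> g t = poly q t / t ^ e" using assms(2) by (rule regular_functions_GmE)
  show ?thesis
    by (rule regular_functions_GmI[of _ "p * q" "d + e"]) (auto simp: f g power_add)
qed

lemma regular_functions_Gm_power_int: "(\<lambda>t. t powi z) \<in> regular_functions_Gm"
proof (cases "z \<ge> 0")
  case True
  then show ?thesis
    by (intro regular_functions_GmI[of _ "Polynomial.monom 1 (nat z)" 0])
      (simp add: poly_monom power_int_def)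
next
  case False
  then show ?thesis
    by (intro regular_functions_GmI[of _ 1 "nat (- z)"])
      (simp add: power_int_def divide_inverse power_inverse)
qed

lemma regular_functions_Gm_cong:
  assumes "g \<in> regular_functions_Gm" "\<And>t. t \<noteq> 0 \<Longrightarrow> f t = g t"
  shows "f \<in> regular_functions_Gm"
proof -
  obtain p d where "\<forall>t. t \<noteq> 0 \<longrightarrow> g t = poly p t / t ^ d" using assms(1) by (rule regular_functions_GmE)
  then show ?thesis by (intro regular_functions_GmI[of _ p d]) (simp add: assms(2))
qed

lemma det_mat_diag: "det (mat_diag n f) = (\<Prod>i<n. f i)"
proof -
  have "det (mat_diag n f) = prod_list (diag_mat (mat_diag n f))"
    by (rule det_upper_triangular[of _ n]) (auto simp: mat_diag_def)
  also have "\<dots> = (\<Prod>i<n. f i)"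
    by (auto simp: prod_list_diag_prod mat_diag_def lessThan_atLeast0 intro!: prod.cong)
  finally show ?thesis .
qed

lemma prod_power_int: "t \<noteq> (0 :: 'a::field) \<Longrightarrow> (\<Prod>i\<in>A. t powi d i) = t powi (\<Sum>i\<in>A. d i)"
  by (induction A rule: infinite_finite_induct) (auto simp: power_int_add)

definition diag_cochar :: "nat \<Rightarrow> (nat \<Rightarrow> int) \<Rightarrow> 'a::field \<Rightarrow> 'a mat" where
  "diag_cochar n d t = mat_diag n (\<lambda>i. t powi d i)"

lemma diag_cochar_carrier_mat [simp]: "diag_cochar n d t \<in> carrier_mat n n"
  by (simp add: diag_cochar_def)

lemma diag_cochar_mult: "diag_cochar n d t * diag_cochar n d u = diag_cochar n d (t * u)"
  by (simp add: diag_cochar_def power_int_mult_distrib)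

lemma diag_cochar_inverse_right:
  assumes "t \<noteq> 0" shows "diag_cochar n d t * diag_cochar n d (inverse t) = 1\<^sub>m n"
  using assms unfolding diag_cochar_mult by (simp add: diag_cochar_def)

lemma diag_cochar_inverse_left:
  assumes "t \<noteq> 0" shows "diag_cochar n d (inverse t) * diag_cochar n d t = 1\<^sub>m n"
  using assms unfolding diag_cochar_mult by (simp add: diag_cochar_def)

lemma diag_cochar_GL: "t \<noteq> 0 \<Longrightarrow> diag_cochar n d t \<in> carrier (GL n)"
  unfolding carrier_GL using diag_cochar_inverse_left diag_cochar_inverse_right
  by (metis diag_cochar_carrier_mat)

lemma GL_mult: "x \<otimes>\<^bsub>GL n\<^esub> y = x * y" and GL_one: "\<one>\<^bsub>GL n\<^esub> = 1\<^sub>m n"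
  by (simp_all add: GL_def units_of_def ring_mat_def)

lemma GL_inv_eqI:
  fixes g :: "'a::field mat"
  assumes "g \<in> carrier_mat n n" "h \<in> carrier_mat n n" "h * g = 1\<^sub>m n"
  shows "g \<in> carrier (GL n)" "inv\<^bsub>GL n\<^esub> g = h"
proof -
  interpret group "GL n :: 'a mat monoid" by (rule group_GL)
  have "g * h = 1\<^sub>m n" using mat_mult_left_right_inverse assms by blast
  then have g: "g \<in> carrier (GL n)" and h: "h \<in> carrier (GL n)"
    using assms by (auto simp: carrier_GL)
  show "g \<in> carrier (GL n)" by fact
  show "inv\<^bsub>GL n\<^esub> g = h"
    using inv_equality[OF _ g h] assms(3) by (simp add: GL_mult GL_one)
qed

lemma inv_diag_cochar: "t \<noteq> 0 \<Longrightarrow> inv\<^bsub>GL n\<^esub> (diag_cochar n d t) = diag_cochar n d (inverse t)"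
  by (rule GL_inv_eqI) (simp_all add: diag_cochar_inverse_left)

text \<open>Induction over the generators of the coordinate ring: along the cocharacter, entries
  become powers of t or 0, and the determinant becomes t to the sum of the weights.\<close>

lemma regular_function_diag_cochar:
  assumes "r \<in> regular_functions_GL_Gm n"
  shows "(\<lambda>t. r (diag_cochar n d t, t powi z)) \<in> regular_functions_Gm"
  using assms
proof induction
  case (const c)
  show ?case by (rule regular_functions_Gm_const)
next
  case (entry i j)
  show ?case
  proof (cases "i = j")
    case True
    then show ?thesis
      by (intro regular_functions_Gm_cong[OF regular_functions_Gm_power_int[of "d j"]])
        (use entry in \<open>simp add: diag_cochar_def mat_diag_def\<close>)
  next
    case False
    then show ?thesis
      by (intro regular_functions_Gm_cong[OF regular_functions_Gm_const[of 0]])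
        (use entry in \<open>simp add: diag_cochar_def mat_diag_def\<close>)
  qed
next
  case inv_det
  show ?case
    by (rule regular_functions_Gm_cong[OF regular_functions_Gm_power_int[of "- (\<Sum>i<n. d i)"]])
      (simp add: diag_cochar_def det_mat_diag prod_power_int power_int_minus)
next
  case coord
  show ?case by (simp add: regular_functions_Gm_power_int)
next
  case inv_coord
  show ?case
    by (rule regular_functions_Gm_cong[OF regular_functions_Gm_power_int[of "- z"]])
      (simp add: power_int_minus)
qed (simp_all add: regular_functions_Gm_add regular_functions_Gm_mult)

definition Qprime_cochar :: "nat \<Rightarrow> (nat \<Rightarrow> int) \<Rightarrow> int \<Rightarrow> 'a::field \<Rightarrow> 'a mat set \<times> 'a" where
  "Qprime_cochar n d z t = (scalar_mats n #>\<^bsub>GL n\<^esub> diag_cochar n d t, t powi z)"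

text \<open>A regular function on the quotient is evaluated on the diagonal representative of the
  coset, where it becomes a Laurent polynomial.\<close>

lemma algebraic_hom_Qprime_cochar: "algebraic_hom n (Qprime_cochar n d z :: 'a::field \<Rightarrow> _)"
  unfolding algebraic_hom_def
proof (intro conjI ballI)
  interpret normal "scalar_mats n" "GL n :: 'a mat monoid" by (rule scalar_mats_normal)
  show "(Qprime_cochar n d z :: 'a \<Rightarrow> _) \<in> hom Gm (Qprime n)"
  proof (rule homI)
    fix t :: 'a assume "t \<in> carrier Gm"
    then show "Qprime_cochar n d z t \<in> carrier (Qprime n)"
      by (auto simp: Qprime_cochar_def Qprime_def DirProd_def PGL_def FactGroup_def Gm_def
          intro!: rcosetsI[OF subset] diag_cochar_GL)
  next
    fix t u :: 'a assume tu: "t \<in> carrier Gm" "u \<in> carrier Gm"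
    have "(scalar_mats n #>\<^bsub>GL n\<^esub> diag_cochar n d t) <#>\<^bsub>GL n\<^esub> (scalar_mats n #>\<^bsub>GL n\<^esub> diag_cochar n d u)
        = scalar_mats n #>\<^bsub>GL n\<^esub> diag_cochar n d (t * u)"
      using tu rcos_sum[of "diag_cochar n d t" "diag_cochar n d u"]
      by (simp add: diag_cochar_GL Gm_def GL_mult diag_cochar_mult)
    then show "Qprime_cochar n d z (t \<otimes>\<^bsub>Gm\<^esub> u) = Qprime_cochar n d z t \<otimes>\<^bsub>Qprime n\<^esub> Qprime_cochar n d z u"
      by (simp add: Qprime_cochar_def Qprime_def DirProd_def PGL_def FactGroup_def Gm_def
          power_int_mult_distrib)
  qed
next
  fix \<phi> :: "'a mat set \<times> 'a \<Rightarrow> 'a" assume "\<phi> \<in> regular_functions_Qprime n"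
  then obtain r where r: "r \<in> regular_functions_GL_Gm n"
    and eq: "\<forall>g \<in> carrier (GL n). \<forall>t \<in> carrier Gm. \<phi> (scalar_mats n #>\<^bsub>GL n\<^esub> g, t) = r (g, t)"
    by (auto simp: regular_functions_Qprime_def)
  show "\<phi> \<circ> Qprime_cochar n d z \<in> regular_functions_Gm"
    by (rule regular_functions_Gm_cong[OF regular_function_diag_cochar[OF r, of d z]])
      (simp add: eq Qprime_cochar_def diag_cochar_GL Gm_def)
qed

text \<open>Rotation multiplies \<pi> by \<open>t powi z\<close>, and conjugation by the diagonal
  matrix scales the entry (i, j) by t to the power \<open>d i - d j\<close>. A monomial entry of
  exponent m is therefore an eigenvector of weight \<open>z * m + d i - d j\<close>.\<close>

lemma graded_almost_commutes:
  fixes N :: "'a::field fls mat"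
  assumes N: "N \<in> carrier_mat n n" and s: "s \<noteq> 0"
    and graded: "\<And>i j. i < n \<Longrightarrow> j < n \<Longrightarrow> N $$ (i, j) \<noteq> 0 \<Longrightarrow>
      \<exists>c m. N $$ (i, j) = fls_monom c m \<and> z * m + d i - d j = s"
  shows "almost_commutes n (Qprime_cochar n d z) N"
  unfolding almost_commutes_def
proof (intro exI[of _ s] conjI ballI s)
  fix t :: 'a assume "t \<in> carrier Gm"
  then have t: "t \<noteq> 0" by (simp add: Gm_def)
  have d: "map_mat fls_const (diag_cochar n d u) = mat_diag n (\<lambda>i. fls_const (u powi d i))" for u :: 'a
    by (auto simp: diag_cochar_def mat_diag_def intro!: eq_matI)
  let ?R = "map_mat (fls_rotate (t powi z)) N"
  have "Qprime_act n (Qprime_cochar n d z t) N = Ad n (diag_cochar n d t) ?R"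
    unfolding Qprime_cochar_def by (rule Qprime_act_coset[OF diag_cochar_GL[OF t] N])
  also have "\<dots> = Matrix.mat n n (\<lambda>(i, j). fls_const (t powi d i) * ?R $$ (i, j)) * mat_diag n (\<lambda>i. fls_const (inverse t powi d i))"
    unfolding Ad_def inv_diag_cochar[OF t] d
    by (subst mat_diag_mult_left[of _ n n]) (use N in simp_all)
  also have "\<dots> = Matrix.mat n n (\<lambda>(i, j). fls_const (t powi d i) * ?R $$ (i, j) * fls_const (inverse t powi d j))"
    by (subst mat_diag_mult_right[of _ n n]) (auto intro!: eq_matI)
  also have "\<dots> = fls_const (t powi s) \<cdot>\<^sub>m N"
  proof (rule eq_matI)
    fix i j assume "i < dim_row (fls_const (t powi s) \<cdot>\<^sub>m N)" "j < dim_col (fls_const (t powi s) \<cdot>\<^sub>m N)"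
    then have ij: "i < n" "j < n" using N by auto
    have tz: "t powi z \<noteq> 0" using t by simp
    have "fls_const (t powi d i) * fls_rotate (t powi z) (N $$ (i, j)) * fls_const (inverse t powi d j) =
        fls_const (t powi s) * N $$ (i, j)"
    proof (cases "N $$ (i, j) = 0")
      case True
      then show ?thesis using fls_rotate_monom[OF tz, of 0 0] by simp
    next
      case False
      then obtain c m where c: "N $$ (i, j) = fls_monom c m" and m: "z * m + d i - d j = s"
        using graded[OF ij] by blast
      have "t powi d i * (t powi z) powi m * inverse t powi d j = t powi s"
        unfolding m[symmetric] using t
        by (simp add: power_int_add power_int_diff power_int_mult[symmetric] power_int_inverse field_simps)
      moreover have "fls_const (t powi d i) * fls_rotate (t powi z) (N $$ (i, j)) * fls_const (inverse t powi d j)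
         = fls_monom (t powi d i * (t powi z) powi m * inverse t powi d j * c) m"
        unfolding c fls_rotate_monom[OF tz] fls_monom_0_right[symmetric] fls_monom_mult
        by (simp add: mult_ac)
      ultimately show ?thesis
        unfolding c fls_monom_0_right[symmetric] by (simp add: fls_monom_mult)
    qed
    then show "Matrix.mat n n (\<lambda>(i, j). fls_const (t powi d i) * ?R $$ (i, j) * fls_const (inverse t powi d j)) $$ (i, j)
        = (fls_const (t powi s) \<cdot>\<^sub>m N) $$ (i, j)"
      using ij N by simp
  qed (use N in auto)
  finally show "Qprime_act n (Qprime_cochar n d z t) N = fls_const (t powi s) \<cdot>\<^sub>m N" .
qed

section \<open>Characteristic polynomials of almost commuting matrices\<close>

text \<open>At a common root x of \<open>P\<close> and its derivative, \<open>P = (X - x) Q\<close>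
  with \<open>Q\<close> still vanishing at x. Then all roots of \<open>P\<close> are roots of
  \<open>Q\<close>, whose degree is one less than the number of these roots.\<close>

lemma pderiv_nonzero_at_simple_root:
  fixes P :: "'a::idom poly"
  assumes card: "card {x. poly P x = 0} = Polynomial.degree P" and P: "P \<noteq> 0" and x: "poly P x = 0"
  shows "poly (pderiv P) x \<noteq> 0"
proof
  assume 0: "poly (pderiv P) x = 0"
  obtain Q where Q: "P = [:-x, 1:] * Q" using x by (auto simp: poly_eq_0_iff_dvd)
  then have Q0: "Q \<noteq> 0" using P by auto
  have "poly Q x = 0" using 0 unfolding Q pderiv_mult by (simp add: pderiv_pCons)
  then have "{y. poly P y = 0} \<subseteq> {y. poly Q y = 0}" unfolding Q by auto
  then have "card {y. poly P y = 0} \<le> Polynomial.degree Q"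
    using card_mono[OF poly_roots_finite[OF Q0]] poly_roots_degree[OF Q0] by (meson le_trans)
  moreover have "Polynomial.degree P = Suc (Polynomial.degree Q)"
    unfolding Q using Q0 by (subst degree_mult_eq) auto
  ultimately show False using card by simp
qed

lemma poly_eqI_infinite:
  fixes p q :: "'a::idom poly"
  assumes "infinite S" "\<And>x. x \<in> S \<Longrightarrow> poly p x = poly q x"
  shows "p = q"
proof (rule ccontr)
  assume "p \<noteq> q"
  then have "finite {x. poly (p - q) x = 0}" by (intro poly_roots_finite) simp
  moreover have "S \<subseteq> {x. poly (p - q) x = 0}" using assms(2) by auto
  ultimately show False using assms(1) finite_subset by blast
qed

section \<open>Characters of the multiplicative group\<close>

lemma infinite_nonzero: "infinite (UNIV :: 'a::zero set) \<Longrightarrow> infinite {t :: 'a. t \<noteq> 0}"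
  using finite_subset[of UNIV "insert (0 :: 'a) {t. t \<noteq> 0}"] by auto

lemma power_int_eq_1_imp_0:
  assumes inf: "infinite (UNIV :: 'a::field set)" and 1: "\<And>t :: 'a. t \<noteq> 0 \<Longrightarrow> t powi w = 1"
  shows "w = 0"
proof (rule ccontr)
  assume w: "w \<noteq> 0"
  let ?k = "nat \<bar>w\<bar>"
  have "t ^ ?k = 1" if "t \<noteq> 0" for t :: 'a
    using 1[OF that] that by (auto simp: power_int_def abs_if power_inverse split: if_splits)
  then have "Polynomial.monom (1 :: 'a) ?k = 1"
    by (intro poly_eqI_infinite[OF infinite_nonzero[OF inf]]) (simp add: poly_monom)
  then have "Polynomial.degree (Polynomial.monom (1 :: 'a) ?k) = 0" by simp
  then show False using w by (simp add: degree_monom_eq)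
qed

text \<open>Clearing the denominator \<open>t ^ d\<close> leaves a polynomial p with p(ut) = p(u)
  p(t). Comparing leading coefficients in t gives p(u) = u to the degree of p.\<close>

lemma regular_character_power_int:
  fixes \<chi> :: "'a::field \<Rightarrow> 'a"
  assumes inf: "infinite (UNIV :: 'a set)" and reg: "\<chi> \<in> regular_functions_Gm"
    and nz: "\<And>t. t \<noteq> 0 \<Longrightarrow> \<chi> t \<noteq> 0"
    and mult: "\<And>t u. t \<noteq> 0 \<Longrightarrow> u \<noteq> 0 \<Longrightarrow> \<chi> (t * u) = \<chi> t * \<chi> u"
  obtains z where "\<And>t. t \<noteq> 0 \<Longrightarrow> \<chi> t = t powi z"
proof -
  obtain p d where p: "\<And>t. t \<noteq> 0 \<Longrightarrow> \<chi> t = poly p t / t ^ d"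
    using reg by (auto simp: regular_functions_Gm_def Gm_def)
  have p0: "p \<noteq> 0" using p[of 1] nz[of 1] by auto
  let ?i = "Polynomial.degree p"
  have pu: "poly p u = u ^ ?i" if u: "u \<noteq> 0" for u
  proof -
    have "poly p (u * t) = poly p u * poly p t" if "t \<noteq> 0" for t
      using mult[OF u that] that u by (simp add: p field_simps power_mult_distrib)
    then have "pcompose p [:0, u:] = Polynomial.smult (poly p u) p"
      by (intro poly_eqI_infinite[OF infinite_nonzero[OF inf]]) (simp add: poly_pcompose mult_ac)
    then have "Polynomial.coeff (pcompose p [:0, u:]) ?i = Polynomial.coeff (Polynomial.smult (poly p u) p) ?i" by simp
    then show ?thesis using p0 by (simp add: coeff_pcompose_linear)
  qed
  show ?thesis
  proof (rule that)
    fix t :: 'a assume t: "t \<noteq> 0"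
    then show "\<chi> t = t powi (int ?i - int d)"
      by (simp add: p pu power_int_diff)
  qed
qed

text \<open>The second component is the coordinate t, a regular function on the quotient, so its
  composition with \<open>f\<close> is a regular character.\<close>

lemma algebraic_hom_snd:
  fixes f :: "'a::field \<Rightarrow> 'a mat set \<times> 'a"
  assumes inf: "infinite (UNIV :: 'a set)" and f: "algebraic_hom n f"
  obtains z where "\<And>t. t \<noteq> 0 \<Longrightarrow> snd (f t) = t powi z"
proof (rule regular_character_power_int[OF inf])
  have hom: "f \<in> hom Gm (Qprime n)" using f by (simp add: algebraic_hom_def)
  have "(snd :: _ \<Rightarrow> 'a) \<in> regular_functions_Qprime n"
    unfolding regular_functions_Qprime_def
    by (intro CollectI bexI[OF _ regular_functions_GL_Gm.coord]) simp
  then have "snd \<circ> f \<in> regular_functions_Gm" using f by (simp add: algebraic_hom_def)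
  then show "(\<lambda>t. snd (f t)) \<in> regular_functions_Gm" by (simp add: o_def)
  show "snd (f t) \<noteq> 0" if "t \<noteq> 0" for t
    using hom_in_carrier[OF hom, of t] that by (auto simp: Qprime_def DirProd_def Gm_def)
  show "snd (f (t * u)) = snd (f t) * snd (f u)" if "t \<noteq> 0" "u \<noteq> 0" for t u
    using hom_mult[OF hom, of t u] that
    by (cases "f t"; cases "f u") (simp add: Qprime_def DirProd_def Gm_def)
qed (use that in blast)

section \<open>Characteristic polynomials under scaling, conjugation and rotation\<close>

text \<open>From det(cx - cA) = \<open>c^n\<close> det(x - A) at every x of an infinite field, hence
  as polynomials in x.\<close>

lemma coeff_char_poly_smult:
  fixes A :: "'a::field mat"
  assumes inf: "infinite (UNIV :: 'a set)" and A: "A \<in> carrier_mat n n" and c: "c \<noteq> 0" and k: "k \<le> n"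
  shows "Polynomial.coeff (char_poly (c \<cdot>\<^sub>m A)) k = c ^ (n - k) * Polynomial.coeff (char_poly A) k"
proof -
  have cA: "c \<cdot>\<^sub>m A \<in> carrier_mat n n" using A by simp
  have "poly (char_poly (c \<cdot>\<^sub>m A)) (c * x) = c ^ n * poly (char_poly A) x" for x
  proof -
    have "- char_matrix (c \<cdot>\<^sub>m A) (c * x) = c \<cdot>\<^sub>m (- char_matrix A x)"
      using A by (intro eq_matI) (auto simp: char_matrix_def algebra_simps)
    then show ?thesis
      unfolding char_poly_matrix[OF A] char_poly_matrix[OF cA] using A by (simp add: char_matrix_def)
  qed
  then have "pcompose (char_poly (c \<cdot>\<^sub>m A)) [:0, c:] = Polynomial.smult (c ^ n) (char_poly A)"
    by (intro poly_eqI_infinite[OF inf]) (simp add: poly_pcompose mult_ac)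
  then have "c ^ k * Polynomial.coeff (char_poly (c \<cdot>\<^sub>m A)) k = c ^ n * Polynomial.coeff (char_poly A) k"
    by (metis coeff_pcompose_linear coeff_smult)
  also have "c ^ n = c ^ k * c ^ (n - k)" using k by (simp add: power_add[symmetric])
  finally show ?thesis using c by simp
qed

text \<open>Conjugation leaves the characteristic polynomial unchanged, and rotation, being a ring
  homomorphism, acts on it coefficientwise. So the rotated coefficients are those of the scaled
  matrix \<open>c N\<close>.\<close>

lemma coeff_char_poly_almost_commutes:
  fixes N :: "'a::field fls mat"
  assumes N: "N \<in> carrier_mat n n" and h: "h \<in> carrier (Qprime n)" and c: "c \<noteq> 0"
    and eq: "Qprime_act n h N = fls_const c \<cdot>\<^sub>m N" and k: "k \<le> n"
  shows "fls_rotate (snd h) (Polynomial.coeff (char_poly N) k) = fls_const (c ^ (n - k)) * Polynomial.coeff (char_poly N) k"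
proof -
  let ?t = "snd h"
  have t: "?t \<noteq> 0" using h by (auto simp: Qprime_def DirProd_def Gm_def)
  obtain g where g: "g \<in> carrier (GL n)" "fst h = scalar_mats n #>\<^bsub>GL n\<^esub> g"
    using h by (auto simp: Qprime_def DirProd_def PGL_def FactGroup_def RCOSETS_def)
  let ?M = "map_mat (fls_rotate ?t) N" and ?h = "inv\<^bsub>GL n\<^esub> g"
  interpret rot: comm_ring_hom "fls_rotate ?t" by (rule comm_ring_hom_fls_rotate[OF t])
  interpret cst: comm_ring_hom "fls_const :: 'a \<Rightarrow> _" by unfold_locales (auto simp: fls_plus_const)
  have "Ad n g ?M = fls_const c \<cdot>\<^sub>m N"
    using Qprime_act_coset[OF g(1) N, of ?t] g(2) eq by (metis prod.collapse)
  moreover have "char_poly (Ad n g ?M) = char_poly ?M"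
  proof (rule char_poly_similar)
    have gC: "g \<in> carrier_mat n n" using g(1) by (simp add: carrier_GL)
    note i = GL_inv[OF g(1)]
    have "map_mat fls_const g * map_mat fls_const ?h = 1\<^sub>m n"
      using cst.mat_hom_mult[OF gC i(2)] i(3) by (simp add: cst.mat_hom_one)
    moreover have "map_mat fls_const ?h * map_mat fls_const g = 1\<^sub>m n"
      using cst.mat_hom_mult[OF i(2) gC] i(4) by (simp add: cst.mat_hom_one)
    ultimately have "similar_mat_wit (Ad n g ?M) ?M (map_mat fls_const g) (map_mat fls_const ?h)"
      by (intro similar_mat_witI[of _ _ n]) (use gC i(2) N in \<open>auto simp: Ad_def\<close>)
    then show "similar_mat (Ad n g ?M) ?M" unfolding similar_mat_def by blast
  qed
  moreover have "char_poly ?M = map_poly (fls_rotate ?t) (char_poly N)"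
    by (rule rot.char_poly_hom[OF N])
  ultimately have "fls_rotate ?t (Polynomial.coeff (char_poly N) k) = Polynomial.coeff (char_poly (fls_const c \<cdot>\<^sub>m N)) k"
    by simp
  also have "\<dots> = fls_const c ^ (n - k) * Polynomial.coeff (char_poly N) k"
    by (rule coeff_char_poly_smult[OF infinite_UNIV_fls N _ k]) (use c in simp)
  also have "fls_const c ^ (n - k) = fls_const (c ^ (n - k))" by (rule cst.hom_power[symmetric])
  finally show ?thesis .
qed

section \<open>Separability, homogeneity and the exponent q\<close>

lemma homogeneous_in_pi_power_iff:
  "homogeneous_in_pi_power n q p \<longleftrightarrow> Polynomial.degree p \<le> n \<and>
     (\<exists>c. \<forall>i\<le>n. Polynomial.coeff p (n - i) = fls_monom (c i) \<lfloor>q * of_nat i\<rfloor> \<and> (c i \<noteq> 0 \<longrightarrow> q * of_nat i \<in> \<int>))"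
  (is "?l \<longleftrightarrow> ?r")
proof -
  have sum: "Polynomial.coeff (\<Sum>i\<le>n. Polynomial.monom (fls_monom (c i) \<lfloor>q * of_nat i\<rfloor>) (n - i)) k =
      (if k \<le> n then fls_monom (c (n - k)) \<lfloor>q * of_nat (n - k)\<rfloor> else 0)" for c :: "nat \<Rightarrow> 'a" and k
  proof -
    have "Polynomial.coeff (\<Sum>i\<le>n. Polynomial.monom (fls_monom (c i) \<lfloor>q * of_nat i\<rfloor>) (n - i)) k =
        (\<Sum>i\<le>n. if i = n - k \<and> k \<le> n then fls_monom (c i) \<lfloor>q * of_nat i\<rfloor> else 0)"
      unfolding coeff_sum coeff_monom by (intro sum.cong) auto
    also have "\<dots> = (if k \<le> n then fls_monom (c (n - k)) \<lfloor>q * of_nat (n - k)\<rfloor> else 0)" by simp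
    finally show ?thesis .
  qed
  have eq: "p = (\<Sum>i\<le>n. Polynomial.monom (fls_monom (c i) \<lfloor>q * of_nat i\<rfloor>) (n - i)) \<longleftrightarrow>
      Polynomial.degree p \<le> n \<and> (\<forall>i\<le>n. Polynomial.coeff p (n - i) = fls_monom (c i) \<lfloor>q * of_nat i\<rfloor>)" for c :: "nat \<Rightarrow> 'a"
  proof (intro iffI conjI allI impI)
    assume p: "p = (\<Sum>i\<le>n. Polynomial.monom (fls_monom (c i) \<lfloor>q * of_nat i\<rfloor>) (n - i))"
    show "Polynomial.degree p \<le> n" by (rule degree_le) (simp add: p sum)
    show "Polynomial.coeff p (n - i) = fls_monom (c i) \<lfloor>q * of_nat i\<rfloor>" if "i \<le> n" for i
      using that by (simp add: p sum)
  next
    assume r: "Polynomial.degree p \<le> n \<and>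
      (\<forall>i\<le>n. Polynomial.coeff p (n - i) = fls_monom (c i) \<lfloor>q * of_nat i\<rfloor>)"
    then have deg: "Polynomial.degree p \<le> n"
      and c: "\<forall>i\<le>n. Polynomial.coeff p (n - i) = fls_monom (c i) \<lfloor>q * of_nat i\<rfloor>" by auto
    show "p = (\<Sum>i\<le>n. Polynomial.monom (fls_monom (c i) \<lfloor>q * of_nat i\<rfloor>) (n - i))"
    proof (rule poly_eqI)
      fix k
      show "Polynomial.coeff p k = Polynomial.coeff (\<Sum>i\<le>n. Polynomial.monom (fls_monom (c i) \<lfloor>q * of_nat i\<rfloor>) (n - i)) k"
        unfolding sum using spec[OF c, of "n - k"] deg by (auto simp: coeff_eq_0)
    qed
  qed
  show ?thesis
    unfolding homogeneous_in_pi_power_def fls_monom_def[symmetric] eq by blast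
qed

text \<open>Regular semisimplicity phrased through the characteristic polynomial, so that it passes
  directly to the other members of a conjugacy class.\<close>

definition separable_char_poly :: "nat \<Rightarrow> 'a::field fls mat \<Rightarrow> bool" where
  "separable_char_poly n N \<longleftrightarrow> N \<in> carrier_mat n n \<and>
     card {x. poly (map_poly to_ac (char_poly N)) x = 0} = n"

lemma eigenvalue_to_ac_iff:
  assumes N: "N \<in> carrier_mat n n"
  shows "eigenvalue (map_mat to_ac N) x \<longleftrightarrow> poly (map_poly to_ac (char_poly N)) x = 0"
proof -
  have "map_mat to_ac N \<in> carrier_mat n n" using N by simp
  then show ?thesis using eigenvalue_root_char_poly to_ac.char_poly_hom[OF N] by metis
qed

lemma separable_char_polyD:
  assumes "separable_char_poly n N"
  shows "N \<in> carrier_mat n n" "Polynomial.degree (char_poly N) = n" "Polynomial.coeff (char_poly N) n = 1"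
    "poly (map_poly to_ac (char_poly N)) x = 0 \<Longrightarrow> poly (pderiv (map_poly to_ac (char_poly N))) x \<noteq> 0"
proof -
  show N: "N \<in> carrier_mat n n" using assms by (simp add: separable_char_poly_def)
  show deg: "Polynomial.degree (char_poly N) = n" and c: "Polynomial.coeff (char_poly N) n = 1"
    using degree_monic_char_poly[OF N] by auto
  assume x: "poly (map_poly to_ac (char_poly N)) x = 0"
  have "map_poly to_ac (char_poly N) \<noteq> 0"
    using c by (metis coeff_0 coeff_map_poly to_ac_0 to_ac_1 zero_neq_one)
  then show "poly (pderiv (map_poly to_ac (char_poly N))) x \<noteq> 0"
    using assms deg x by (intro pderiv_nonzero_at_simple_root) (simp_all add: separable_char_poly_def)
qed

text \<open>The two coefficients are the value and the derivative at 0, and 0 is not a multiple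
  root.\<close>

lemma separable_char_poly_coeff_nonzero:
  assumes "separable_char_poly n N"
  shows "Polynomial.coeff (char_poly N) 0 \<noteq> 0 \<or> Polynomial.coeff (char_poly N) 1 \<noteq> 0"
proof -
  let ?P = "map_poly to_ac (char_poly N)"
  have "poly ?P 0 = to_ac (Polynomial.coeff (char_poly N) 0)" "poly (pderiv ?P) 0 = to_ac (Polynomial.coeff (char_poly N) 1)"
    by (simp_all add: poly_0_coeff_0 coeff_pderiv)
  then show ?thesis using separable_char_polyD(4)[OF assms, of 0] by auto
qed

lemma homogeneous_if_almost_commutes:
  fixes N :: "'a::alg_closed_field fls mat"
  assumes n: "n \<ge> 2" and sep: "separable_char_poly n N"
    and f: "algebraic_hom n f" and ac: "almost_commutes n f N"
  obtains q :: rat where "q \<noteq> 0"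
    "(\<exists>a :: int. q = of_int a / of_nat (n - 1)) \<or> (\<exists>a :: int. q = of_int a / of_nat n)"
    "homogeneous_in_pi_power n q (char_poly N)"
proof -
  let ?p = "char_poly N"
  note N = separable_char_polyD(1)[OF sep]
  note inf = infinite_UNIV_alg_closed[where ?'a = 'a]
  obtain z where z: "\<And>t. t \<noteq> 0 \<Longrightarrow> snd (f t) = t powi z"
    by (rule algebraic_hom_snd[OF inf f]) blast
  obtain s where s: "s \<noteq> 0" and act: "\<And>t. t \<noteq> 0 \<Longrightarrow> Qprime_act n (f t) N = fls_const (t powi s) \<cdot>\<^sub>m N"
    using ac by (auto simp: almost_commutes_def Gm_def)
  \<comment> \<open>Comparing the coefficients at \<open>\<pi>^m\<close> gives equal powers of t for
    every nonzero t. Over an infinite field the exponents must agree, so the coefficient of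
    \<open>\<mu>^(n-i)\<close> lives in the single degree \<open>i * s / z\<close>.\<close>
  have key: "z * m = s * int i" if i: "i \<le> n" and nz: "fls_nth (Polynomial.coeff ?p (n - i)) m \<noteq> 0" for i m
  proof -
    have "t powi (z * m - s * int i) = 1" if t: "t \<noteq> 0" for t :: 'a
    proof -
      have "f t \<in> carrier (Qprime n)"
        using f t by (auto simp: algebraic_hom_def Gm_def intro: hom_in_carrier)
      from coeff_char_poly_almost_commutes[OF N this _ act[OF t], of "n - i"]
      have "fls_rotate (t powi z) (Polynomial.coeff ?p (n - i)) = fls_const ((t powi s) ^ i) * Polynomial.coeff ?p (n - i)"
        using t i by (simp add: z)
      then have "fls_nth (fls_rotate (t powi z) (Polynomial.coeff ?p (n - i))) m =
          fls_nth (fls_const ((t powi s) ^ i) * Polynomial.coeff ?p (n - i)) m" by simp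
      then have "(t powi z) powi m = (t powi s) ^ i"
        using t nz by simp
      then show ?thesis
        using t by (simp add: power_int_diff power_int_mult)
    qed
    then have "z * m - s * int i = 0" by (rule power_int_eq_1_imp_0[OF inf])
    then show ?thesis by simp
  qed
  \<comment> \<open>One nonzero coefficient with index n or n - 1 does two things: it forces z to be
    nonzero, as \<open>s * i0\<close> is, and it shows that q has denominator dividing
    \<open>i0\<close>.\<close>
  obtain i0 where i0: "i0 = n \<or> i0 = n - 1" "Polynomial.coeff ?p (n - i0) \<noteq> 0"
    using separable_char_poly_coeff_nonzero[OF sep] n
    by (metis One_nat_def diff_diff_cancel diff_self_eq_0 le_trans one_le_numeral)
  then have i0': "i0 \<le> n" "i0 > 0" using n by auto
  obtain m0 where m0: "fls_nth (Polynomial.coeff ?p (n - i0)) m0 \<noteq> 0" using i0(2) by (auto simp: fls_eq_iff)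
  note k0 = key[OF i0'(1) m0]
  have z0: "z \<noteq> 0" using k0 s i0'(2) by auto
  define q :: rat where "q = of_int s / of_int z"
  have qi: "q * of_nat i = of_int m" if "z * m = s * int i" for i m
  proof -
    have "(of_int z * of_int m :: rat) = of_int s * of_nat i"
      using that by (metis of_int_mult of_int_of_nat_eq)
    then show ?thesis using z0 by (simp add: q_def field_simps)
  qed
  show ?thesis
  proof
    show "q \<noteq> 0" using s z0 by (simp add: q_def)
    have "q = of_int m0 / of_nat i0" using qi[OF k0] i0'(2) by (simp add: field_simps)
    then show "(\<exists>a :: int. q = of_int a / of_nat (n - 1)) \<or> (\<exists>a :: int. q = of_int a / of_nat n)"
      using i0(1) by blast
    show "homogeneous_in_pi_power n q ?p"
      unfolding homogeneous_in_pi_power_iff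
    proof (intro conjI exI[of _ "\<lambda>i. fls_nth (Polynomial.coeff ?p (n - i)) \<lfloor>q * of_nat i\<rfloor>"] allI impI)
      show "Polynomial.degree ?p \<le> n" using separable_char_polyD(2)[OF sep] by simp
      fix i assume i: "i \<le> n"
      \<comment> \<open>Every exponent in the support equals \<open>q * i\<close>, which is then its
        own floor; if the support is empty, both sides are 0.\<close>
      have "m = \<lfloor>q * of_nat i\<rfloor>" if "fls_nth (Polynomial.coeff ?p (n - i)) m \<noteq> 0" for m
        using qi[OF key[OF i that]] by simp
      then show "Polynomial.coeff ?p (n - i) = fls_monom (fls_nth (Polynomial.coeff ?p (n - i)) \<lfloor>q * of_nat i\<rfloor>) \<lfloor>q * of_nat i\<rfloor>"
        by (auto simp: fls_eq_iff)
      assume "fls_nth (Polynomial.coeff ?p (n - i)) \<lfloor>q * of_nat i\<rfloor> \<noteq> 0"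
      then show "q * of_nat i \<in> \<int>" using qi[OF key[OF i]] by (metis Ints_of_int)
    qed
  qed
qed

text \<open>Some coefficient of index n or n - 1 is a nonzero monomial. For negative q its exponent
  would be negative, since its index is positive.\<close>

lemma nonneg_exponent_if_integral:
  fixes N :: "'a::field fls mat"
  assumes n: "n \<ge> 2" and sep: "separable_char_poly n N" and hom: "homogeneous_in_pi_power n q (char_poly N)"
    and int: "\<And>k m. m < 0 \<Longrightarrow> fls_nth (Polynomial.coeff (char_poly N) k) m = 0"
  shows "q \<ge> 0"
proof (rule ccontr)
  assume "\<not> q \<ge> 0"
  obtain c where c: "\<And>i. i \<le> n \<Longrightarrow> Polynomial.coeff (char_poly N) (n - i) = fls_monom (c i) \<lfloor>q * of_nat i\<rfloor>"
    using hom by (auto simp: homogeneous_in_pi_power_iff)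
  obtain i where i: "i = n \<or> i = n - 1" "Polynomial.coeff (char_poly N) (n - i) \<noteq> 0"
    using separable_char_poly_coeff_nonzero[OF sep] n
    by (metis One_nat_def diff_diff_cancel diff_self_eq_0 le_trans one_le_numeral)
  then have i': "i \<le> n" "i > 0" using n by auto
  have "q * of_nat i < 0" using \<open>\<not> q \<ge> 0\<close> i'(2) by (simp add: mult_neg_pos)
  then have "\<lfloor>q * of_nat i\<rfloor> < 0" by simp
  then have "c i = 0" using int[of "\<lfloor>q * of_nat i\<rfloor>" "n - i"] c[OF i'(1)] by simp
  then show False using i(2) c[OF i'(1)] by simp
qed

lemma coeff_char_poly_integral:
  fixes N' :: "'a::field fps mat"
  assumes N': "N' \<in> carrier_mat n n" and m: "m < 0"
  shows "fls_nth (Polynomial.coeff (char_poly (map_mat fps_to_fls N')) k) m = 0"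
proof -
  interpret comm_ring_hom "fps_to_fls :: 'a fps \<Rightarrow> _"
    by unfold_locales (simp_all add: fls_times_fps_to_fls)
  show ?thesis using m by (simp add: char_poly_hom[OF N'])
qed

section \<open>Block matrices with monomial entries\<close>

text \<open>
  Diagonal blocks \<open>k < m\<close> of size \<open>b\<close> with characteristic polynomial \<open>\<mu>\<^sup>b - al k \<cdot> \<pi>\<^sup>a\<close>; the remaining
  rows and columns vanish. Row \<open>i\<close> ends its block iff \<open>Suc (i mod b) = b\<close>, and \<open>j + b = Suc i\<close> then
  selects the first column of that block.
\<close>

definition block_mat :: "nat \<Rightarrow> nat \<Rightarrow> nat \<Rightarrow> int \<Rightarrow> (nat \<Rightarrow> 'a::field) \<Rightarrow> 'a fls mat" where
  "block_mat n b m a al = Matrix.mat n n (\<lambda>(i, j).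
     if i \<ge> m * b then 0
     else if Suc (i mod b) = b then (if j + b = Suc i then fls_monom (al (i div b)) a else 0)
     else (if j = Suc i then 1 else 0))"

lemma block_mat_carrier [simp]: "block_mat n b m a al \<in> carrier_mat n n"
  and block_mat_dim [simp]: "dim_row (block_mat n b m a al) = n" "dim_col (block_mat n b m a al) = n"
  by (simp_all add: block_mat_def)

lemma block_first_index:
  assumes "Suc (i mod b) = b" "j + b = Suc i"
  shows "j div b = i div b" "j mod b = (0::nat)"
proof -
  have "j = i div b * b" using assms div_mult_mod_eq[of i b] by linarith
  moreover have "b > 0" using assms by simp
  ultimately show "j div b = i div b" "j mod b = 0" by simp_all
qed

lemma Suc_mod_div_no_wrap:
  assumes "b > 0" "Suc (i mod b) \<noteq> b"
  shows "Suc i div b = i div b" "Suc i mod b = Suc (i mod b)"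
  using assms by (auto simp: div_Suc mod_Suc)

lemma eigenvalueI_right:
  fixes A :: "'a::field mat"
  assumes A: "A \<in> carrier_mat n n" and k: "k < n" "x k \<noteq> 0"
    and eq: "\<And>i. i < n \<Longrightarrow> (\<Sum>j<n. A $$ (i, j) * x j) = l * x i"
  shows "eigenvalue A l"
  unfolding eigenvalue_def eigenvector_def
proof (intro exI[of _ "vec n x"] conjI)
  show "vec n x \<in> carrier_vec (dim_row A)" using A by simp
  show "vec n x \<noteq> 0\<^sub>v (dim_row A)" using A k by (metis carrier_matD(1) index_vec index_zero_vec(1))
  show "A *\<^sub>v vec n x = l \<cdot>\<^sub>v vec n x"
    using A eq by (intro eq_vecI) (auto simp: scalar_prod_def lessThan_atLeast0)
qed

text \<open>The eigenvector is (1, x, ..., \<open>x^(b-1)\<close>) on block \<open>k\<close> and 0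
  elsewhere: inner rows shift by one power of x, and the last row of the block uses the equation for
  \<open>x ^ b\<close>.\<close>

lemma block_mat_eigenvalue:
  fixes al :: "nat \<Rightarrow> 'a::field"
  assumes b: "b > 0" and n: "m * b \<le> n" and k: "k < m" and x: "x ^ b = to_ac (fls_monom (al k) a)"
  shows "eigenvalue (map_mat to_ac (block_mat n b m a al)) x"
proof -
  let ?B = "block_mat n b m a al"
  let ?v = "\<lambda>i. if i div b = k then x ^ (i mod b) else 0"
  have "Suc k * b \<le> m * b" using k by (intro mult_le_mono1) simp
  then have kb: "k * b < n" using n b by simp
  show ?thesis
  proof (rule eigenvalueI_right[of _ n "k * b" ?v])
    fix i assume i: "i < n"
    have "(\<Sum>j<n. map_mat to_ac ?B $$ (i, j) * ?v j) = (\<Sum>j<n. to_ac (?B $$ (i, j)) * ?v j)"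
      using i by (intro sum.cong) auto
    also have "\<dots> = x * ?v i"
    proof -
      consider "i \<ge> m * b" | "i < m * b" "Suc (i mod b) = b" | "i < m * b" "Suc (i mod b) \<noteq> b" by linarith
      then show ?thesis
      proof cases
        case 1
        then have "i div b \<ge> m" using b by (simp add: less_eq_div_iff_mult_less_eq)
        then show ?thesis using 1 i k by (simp add: block_mat_def)
      next
        case 2
        let ?j = "Suc i - b"
        have j: "?j + b = Suc i" using 2(2) by (metis Suc_le_mono le_add_diff_inverse2 mod_less_eq_dividend)
        have "(\<Sum>j<n. to_ac (?B $$ (i, j)) * ?v j) =
            (\<Sum>j<n. if j = ?j then to_ac (fls_monom (al (i div b)) a) * ?v j else 0)"
          using i 2 j by (intro sum.cong) (auto simp: block_mat_def)
        also have "\<dots> = to_ac (fls_monom (al (i div b)) a) * ?v ?j" using i j b by (subst sum.delta) auto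
        also have "\<dots> = x * ?v i"
          using block_first_index[OF 2(2) j] x 2(2) by (auto simp flip: power_Suc)
        finally show ?thesis .
      next
        case 3
        \<comment> \<open>An inner row is not the last of its block, so \<open>Suc i\<close> is in
          the same block and the column is in range.\<close>
        have "i div b < m" using 3(1) by (simp add: less_mult_imp_div_less)
        then have "Suc i div b < m" using Suc_mod_div_no_wrap[OF b 3(2)] by simp
        then have "Suc i < m * b" using b by (simp add: div_less_iff_less_mult)
        then have "Suc i < n" using n by simp
        moreover have "(\<Sum>j<n. to_ac (?B $$ (i, j)) * ?v j) = (\<Sum>j<n. if j = Suc i then ?v j else 0)"
          using i 3 by (intro sum.cong) (auto simp: block_mat_def)
        ultimately have "(\<Sum>j<n. to_ac (?B $$ (i, j)) * ?v j) = ?v (Suc i)" by simp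
        then show ?thesis using Suc_mod_div_no_wrap[OF b 3(2)] by simp
      qed
    qed
    finally show "(\<Sum>j<n. map_mat to_ac ?B $$ (i, j) * ?v j) = x * ?v i" .
  qed (use kb b in simp_all)
qed

text \<open>Column \<open>m * b\<close>, the first one after the blocks, vanishes: an entry 1 there
  would come from the row just before, which ends a block. So its unit vector is in the
  kernel.\<close>

lemma block_mat_eigenvalue_0:
  fixes al :: "nat \<Rightarrow> 'a::field"
  assumes b: "b > 0" and n: "m * b < n"
  shows "eigenvalue (map_mat to_ac (block_mat n b m a al)) 0"
proof -
  let ?B = "block_mat n b m a al"
  have 0: "?B $$ (i, m * b) = 0" if i: "i < n" for i
  proof -
    have "m * b \<noteq> Suc i" if "Suc (i mod b) \<noteq> b"
      using Suc_mod_div_no_wrap(2)[OF b that] by (metis mod_mult_self2_is_0 nat.distinct(1))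
    then show ?thesis using i n b by (auto simp: block_mat_def)
  qed
  show ?thesis
  proof (rule eigenvalueI_right[of _ n "m * b" "\<lambda>j. if j = m * b then 1 else 0"])
    fix i assume i: "i < n"
    have "(\<Sum>j<n. map_mat to_ac ?B $$ (i, j) * (if j = m * b then 1 else 0)) =
        (\<Sum>j<n. if j = m * b then to_ac (?B $$ (i, j)) else 0)"
      using i by (intro sum.cong) auto
    also have "\<dots> = 0" using 0[OF i] n by simp
    finally show "(\<Sum>j<n. map_mat to_ac ?B $$ (i, j) * (if j = m * b then 1 else 0)) =
        0 * (if i = m * b then 1 else 0)" by simp
  qed (use n in simp_all)
qed

text \<open>This is the grading of the block matrix: with diagonal weights
  \<open>- a * (i mod b)\<close> and rotation weight b, all nonzero entries have weight a. They also
  stay inside one block, so a diagonal matrix constant on blocks commutes with it.\<close>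

lemma block_mat_nonzeroE:
  assumes "i < n" "j < n" "block_mat n b m a al $$ (i, j) \<noteq> 0" "b > 0"
  obtains c k where "block_mat n b m a al $$ (i, j) = fls_monom c k"
    "int b * k - a * int (i mod b) + a * int (j mod b) = a" "i < m * b" "i div b = j div b"
proof (cases "Suc (i mod b) = b")
  case True
  then have j: "j + b = Suc i" and i: "i < m * b"
    using assms by (auto simp: block_mat_def split: if_splits)
  have ib: "int (i mod b) = int b - 1" using True by linarith
  have "int b * a - a * int (i mod b) = a" unfolding ib by (simp add: algebra_simps)
  then show ?thesis
    using assms True j i block_first_index[OF True j]
    by (intro that[of "al (i div b)" a]) (auto simp: block_mat_def)
next
  case False
  then have j: "j = Suc i" and i: "i < m * b"
    using assms by (auto simp: block_mat_def split: if_splits)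
  show ?thesis
    using assms False i j Suc_mod_div_no_wrap[OF assms(4) False]
    by (intro that[of 1 0]) (auto simp: block_mat_def fls_monom_1_0 algebra_simps)
qed

section \<open>Homogeneous characteristic polynomials\<close>

text \<open>With q = a/b in lowest terms, integrality of \<open>q * i\<close> forces b to divide i,
  and the floor becomes the exact \<open>a * int (i div b)\<close>. For the other i both monomials
  are 0.\<close>

lemma homogeneous_coeffsE:
  fixes p :: "'a::field fls poly"
  assumes hom: "homogeneous_in_pi_power n q p"
  obtains a :: int and b :: nat and c :: "nat \<Rightarrow> 'a" where "b > 0" "q = of_int a / of_nat b"
    "\<forall>i\<le>n. c i \<noteq> 0 \<longrightarrow> b dvd i"
    "\<forall>i\<le>n. Polynomial.coeff p (n - i) = fls_monom (c i) (a * int (i div b))"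
proof -
  obtain c where c: "\<And>i. i \<le> n \<Longrightarrow> Polynomial.coeff p (n - i) = fls_monom (c i) \<lfloor>q * of_nat i\<rfloor>"
    and int: "\<And>i. i \<le> n \<Longrightarrow> c i \<noteq> 0 \<Longrightarrow> q * of_nat i \<in> \<int>"
    using hom by (auto simp: homogeneous_in_pi_power_iff)
  obtain a b' where ab: "quotient_of q = (a, b')" by (cases "quotient_of q")
  have b': "b' > 0" "coprime a b'" "q = of_int a / of_int b'"
    using quotient_of_denom_pos[OF ab] quotient_of_coprime[OF ab] quotient_of_div[OF ab] by auto
  define b where "b = nat b'"
  have b: "b > 0" "coprime a (int b)" "q = of_int a / of_nat b" using b' by (auto simp: b_def)
  have dvd: "b dvd i" if i: "i \<le> n" "c i \<noteq> 0" for i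
  proof -
    obtain k where "q * of_nat i = of_int k" using int[OF i] by (auto elim: Ints_cases)
    then have "(of_int (a * int i) :: rat) = of_int (k * int b)" using b(1,3) by (simp add: field_simps)
    then have "a * int i = k * int b" by (simp only: of_int_eq_iff)
    then have "int b dvd a * int i" by simp
    then have "int b dvd int i" using b(2) by (simp add: coprime_dvd_mult_right_iff coprime_commute)
    then show ?thesis by simp
  qed
  have "fls_monom (c i) \<lfloor>q * of_nat i\<rfloor> = fls_monom (c i) (a * int (i div b))" if i: "i \<le> n" for i
  proof (cases "c i = 0")
    case False
    then obtain j where "i = b * j" using dvd[OF i] by auto
    then have "q * of_nat i = of_int (a * int (i div b))" using b(1,3) by simp
    then show ?thesis by (simp only: floor_of_int)
  qed simp
  then show ?thesis using b(1,3) dvd c by (intro that[of b a c]) auto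
qed

lemma (in comm_ring_hom) poly_map_poly_prod_mset_linear:
  "poly (map_poly hom (\<Prod>x\<in>#A. [:-x, 1:])) y = (\<Prod>x\<in>#A. y - hom x)"
proof (induction A)
  case (add x A)
  interpret map_poly_hom: map_poly_comm_ring_hom hom ..
  have "map_poly hom (\<Prod>x\<in>#add_mset x A. [:-x, 1:]) = map_poly hom [:-x, 1:] * map_poly hom (\<Prod>x\<in>#A. [:-x, 1:])"
    by (simp only: image_mset_add_mset prod_mset.add_mset map_poly_hom.hom_mult)
  also have "map_poly hom [:-x, 1:] = [:- hom x, 1:]" by (simp add: map_poly_pCons hom_uminus)
  finally show ?case using add by (simp only: poly_mult) simp
qed simp

lemma poly_eq_sum_coeffs:
  fixes p :: "'a::comm_ring_1 poly"
  assumes "Polynomial.degree p \<le> m"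
  shows "poly p y = (\<Sum>k\<le>m. Polynomial.coeff p k * y ^ k)"
proof -
  have "(\<Sum>k\<le>Polynomial.degree p. Polynomial.coeff p k * y ^ k) = (\<Sum>k\<le>m. Polynomial.coeff p k * y ^ k)"
    by (rule sum.mono_neutral_left) (use assms in \<open>auto simp: coeff_eq_0\<close>)
  then show ?thesis by (simp add: poly_altdef)
qed

text \<open>The substitution \<open>y = x^b / \<pi>^a\<close> turns p(x) into
  \<open>x^e \<pi>^(am) h(y)\<close>, where h is monic of degree m with constants as coefficients.
  It splits over the algebraically closed field of constants, and \<open>al\<close> lists its
  roots.\<close>

lemma root_power_of_homogeneous:
  fixes p :: "'a::alg_closed_field fls poly"
  assumes b: "b > 0" and n: "n = m * b + e" and e: "e = 0 \<or> c n = 0" and e1: "e \<le> 1"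
    and deg: "Polynomial.degree p = n" and monic: "Polynomial.coeff p n = 1"
    and dvd: "\<forall>i\<le>n. c i \<noteq> 0 \<longrightarrow> b dvd i"
    and c: "\<forall>i\<le>n. Polynomial.coeff p (n - i) = fls_monom (c i) (a * int (i div b))"
  obtains al :: "nat \<Rightarrow> 'a" where
    "\<forall>x. poly (map_poly to_ac p) x = 0 \<longrightarrow> x \<noteq> 0 \<longrightarrow> (\<exists>k<m. x ^ b = to_ac (fls_monom (al k) a))"
proof -
  let ?h = "\<Sum>j\<le>m. Polynomial.monom (c (b * j)) (m - j)"
  have c0: "c 0 = 1"
  proof -
    have "fls_monom (c 0) 0 = 1" using c[rule_format, of 0] monic by simp
    then show ?thesis by (simp add: fls_monom_0_right)
  qed
  have coeff_h: "Polynomial.coeff ?h k = c (b * (m - k))" if "k \<le> m" for k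
  proof -
    have "Polynomial.coeff ?h k = (\<Sum>j\<le>m. if j = m - k then c (b * j) else 0)"
      unfolding coeff_sum coeff_monom using that by (intro sum.cong) auto
    then show ?thesis by simp
  qed
  have hm: "Polynomial.coeff ?h m = 1" using coeff_h[of m] c0 by simp
  have "Polynomial.degree ?h \<le> m"
    by (rule degree_sum_le) (auto intro: order.trans[OF degree_monom_le])
  then have degh: "Polynomial.degree ?h = m" using hm by (metis le_antisym le_degree zero_neq_one)
  obtain A where A: "size A = m" "?h = (\<Prod>x\<in>#A. [:-x, 1:])"
    using alg_closed_imp_factorization[of ?h] hm degh by force
  obtain xs where xs: "mset xs = A" using ex_mset by blast
  interpret h: comm_ring_hom "\<lambda>z :: 'a. to_ac (fls_const z)"
    by unfold_locales (simp_all add: fls_plus_const[symmetric] fls_const_mult_const[symmetric]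
        del: fls_const_mult_const)
  show ?thesis
  proof (rule that[of "\<lambda>k. xs ! k"], intro allI impI)
    fix x assume root: "poly (map_poly to_ac p) x = 0" and x: "x \<noteq> 0"
    let ?T = "to_ac (fls_monom 1 a :: 'a fls)"
    define y where "y = x ^ b / ?T"
    have T: "?T \<noteq> 0" by simp
    have xb: "x ^ b = y * ?T" using T by (simp add: y_def)
    have c': "Polynomial.coeff p k = fls_monom (c (n - k)) (a * int ((n - k) div b))" if "k \<le> n" for k
      using c[rule_format, of "n - k"] that by simp
    have "0 = (\<Sum>k\<le>n. to_ac (Polynomial.coeff p k) * x ^ k)"
      using root deg by (simp add: poly_altdef)
    also have "\<dots> = (\<Sum>i\<le>n. to_ac (fls_monom (c i) (a * int (i div b))) * x ^ (n - i))"
      by (rule sum.reindex_bij_witness[of _ "\<lambda>i. n - i" "\<lambda>i. n - i"]) (auto simp: c')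
    also have "\<dots> = (\<Sum>i\<in>(\<lambda>j. b * j) ` {..m}. to_ac (fls_monom (c i) (a * int (i div b))) * x ^ (n - i))"
    proof (rule sum.mono_neutral_right)
      show "(\<lambda>j. b * j) ` {..m} \<subseteq> {..n}" using n by (auto simp: mult.commute trans_le_add1)
      \<comment> \<open>A multiple of b beyond \<open>b * m\<close> that is at most n can only be n
        itself, with e = 1; there \<open>c n = 0\<close> by assumption.\<close>
      have "c i = 0" if i: "i \<le> n" "i \<notin> (\<lambda>j. b * j) ` {..m}" for i
      proof (rule ccontr)
        assume ci: "c i \<noteq> 0"
        then obtain j where j: "i = b * j" using dvd i(1) by auto
        then have "j > m" using i(2) by auto
        then have "Suc m * b \<le> i" unfolding j by (metis Suc_leI mult.commute mult_le_mono2)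
        then have "i \<ge> m * b + 1" using b by simp
        then have "i = n \<and> e = 1" using i(1) n e1 by auto
        then show False using e ci by simp
      qed
      then show "\<forall>i\<in>{..n} - (\<lambda>j. b * j) ` {..m}. to_ac (fls_monom (c i) (a * int (i div b))) * x ^ (n - i) = 0"
        by auto
    qed simp
    also have "\<dots> = (\<Sum>j\<le>m. to_ac (fls_monom (c (b * j)) (a * int j)) * x ^ (n - b * j))"
      using b by (subst sum.reindex) (auto simp: inj_on_def)
    also have "\<dots> = (\<Sum>j\<le>m. x ^ e * ?T ^ m * (to_ac (fls_const (c (b * j))) * y ^ (m - j)))"
    proof (rule sum.cong[OF refl])
      fix j assume "j \<in> {..m}"
      then have j: "j \<le> m" by simp
      have "n - b * j = e + b * (m - j)" using j unfolding n
        by (simp add: diff_mult_distrib2 mult.commute)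
      then have 1: "x ^ (n - b * j) = x ^ e * (y ^ (m - j) * ?T ^ (m - j))"
        by (simp add: power_add power_mult xb power_mult_distrib)
      have "fls_monom (c (b * j)) (a * int j) = fls_const (c (b * j)) * fls_monom 1 a ^ j"
        by (simp add: fls_monom_power fls_monom_0_right[symmetric] fls_monom_mult mult.commute)
      then have 2: "to_ac (fls_monom (c (b * j)) (a * int j)) = to_ac (fls_const (c (b * j))) * ?T ^ j"
        by (simp only: to_ac_mult to_ac_power)
      have 3: "?T ^ m = ?T ^ j * ?T ^ (m - j)" using j by (simp add: power_add[symmetric])
      show "to_ac (fls_monom (c (b * j)) (a * int j)) * x ^ (n - b * j) =
          x ^ e * ?T ^ m * (to_ac (fls_const (c (b * j))) * y ^ (m - j))"
        unfolding 1 2 3 by (simp only: mult_ac)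
    qed
    also have "\<dots> = x ^ e * ?T ^ m * poly (map_poly (\<lambda>z. to_ac (fls_const z)) ?h) y"
    proof -
      have "poly (map_poly (\<lambda>z. to_ac (fls_const z)) ?h) y =
          (\<Sum>k\<le>m. Polynomial.coeff (map_poly (\<lambda>z. to_ac (fls_const z)) ?h) k * y ^ k)"
        by (rule poly_eq_sum_coeffs) (use degh degree_map_poly_le[of "\<lambda>z. to_ac (fls_const z)" ?h] in linarith)
      also have "\<dots> = (\<Sum>k\<le>m. to_ac (fls_const (c (b * (m - k)))) * y ^ k)"
        by (intro sum.cong refl) (simp only: h.coeff_map_poly_hom coeff_h atMost_iff)
      also have "\<dots> = (\<Sum>j\<le>m. to_ac (fls_const (c (b * j))) * y ^ (m - j))"
        by (rule sum.reindex_bij_witness[of _ "\<lambda>j. m - j" "\<lambda>j. m - j"]) auto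
      finally show ?thesis by (simp only: sum_distrib_left)
    qed
    finally have "poly (map_poly (\<lambda>z. to_ac (fls_const z)) ?h) y = 0" using x T by simp
    moreover have "poly (map_poly (\<lambda>z. to_ac (fls_const z)) ?h) y = (\<Prod>z\<in>#A. y - to_ac (fls_const z))"
      unfolding A(2) by (rule h.poly_map_poly_prod_mset_linear)
    ultimately obtain z where z: "z \<in># A" "y = to_ac (fls_const z)" by auto
    then obtain k where k: "k < m" "xs ! k = z" using xs A(1) by (metis in_set_conv_nth set_mset_mset size_mset)
    have "to_ac (fls_monom z a) = to_ac (fls_const z) * ?T"
      by (simp add: fls_monom_0_right[symmetric] fls_monom_mult flip: to_ac_mult)
    then have "x ^ b = to_ac (fls_monom (xs ! k) a)" using xb z k by simp
    then show "\<exists>k<m. x ^ b = to_ac (fls_monom (xs ! k) a)" using k(1) by blast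
  qed
qed

text \<open>All exponents of \<mu> are multiples of b, so if b vanished in the field, the derivative
  would be identically 0 and every root would be multiple.\<close>

lemma char_not_dvd_if_separable:
  fixes N :: "'a::field fls mat"
  assumes sep: "separable_char_poly n N" and n: "n > 0" "b dvd n"
    and dvd: "\<forall>i\<le>n. Polynomial.coeff (char_poly N) (n - i) \<noteq> 0 \<longrightarrow> b dvd i"
  shows "of_nat b \<noteq> (0 :: 'a)"
proof
  assume "of_nat b = (0 :: 'a)"
  then have "of_nat b = (0 :: 'a fls)" by (simp add: fls_of_nat)
  then have b0: "of_nat b = (0 :: 'a fls alg_closure)" using to_ac_of_nat[of b, where ?'a = "'a fls"] by simp
  let ?P = "map_poly to_ac (char_poly N)"
  have "Polynomial.coeff (pderiv ?P) k = 0" for k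
  proof (cases "Polynomial.coeff (char_poly N) (Suc k) = 0")
    case False
    then have k: "Suc k \<le> n" using separable_char_polyD(2)[OF sep] le_degree by blast
    then have "b dvd n - Suc k" using dvd[rule_format, of "n - Suc k"] False by simp
    then have "b dvd Suc k" using n k by (metis dvd_diff_nat diff_diff_cancel)
    then obtain j where "Suc k = b * j" by auto
    then have "of_nat (Suc k) = (0 :: 'a fls alg_closure)" using b0 by (metis mult_zero_left of_nat_mult)
    then show ?thesis by (simp only: coeff_pderiv) simp
  qed (simp add: coeff_pderiv)
  then have 0: "pderiv ?P = 0" by (simp add: poly_eq_iff)
  have "card {x. poly ?P x = 0} = n" using sep by (simp add: separable_char_poly_def)
  then obtain x where "poly ?P x = 0" using n(1) by fastforce
  then show False using separable_char_polyD(4)[OF sep] 0 by simp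
qed

section \<open>Construction of the almost commuting representative\<close>

text \<open>The diagonal factor \<open>h\<close> is used to correct a determinant. Its part
  \<open>w\<close> is constant on blocks and so commutes with the block matrix; its monomial part
  only changes the grading.\<close>

lemma diagonal_with_det:
  fixes d :: "'a::field fls"
  assumes d: "d \<noteq> 0" and n: "n = m * b + e" "n > 0" and b: "b > 0"
    and e: "e = 1 \<or> e = 0 \<and> of_nat b \<noteq> (0 :: 'a)"
  obtains h w :: "nat \<Rightarrow> 'a fls" and u :: "nat \<Rightarrow> 'a" and M :: "nat \<Rightarrow> int" where
    "(\<Prod>i<n. h i) = d" "\<forall>i. h i = fls_monom (u i) (M i) * w i" "\<forall>i. u i \<noteq> 0 \<and> w i \<noteq> 0"
    "\<forall>i j. i < m * b \<longrightarrow> i div b = j div b \<longrightarrow> w i = w j"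
  using e
proof
  assume e: "e = 1"
  \<comment> \<open>Below n, the condition holds only for the index \<open>m * b\<close> outside the
    blocks, so the product is \<open>d\<close>.\<close>
  let ?w = "\<lambda>i. if i div b = m then d else 1"
  have "(\<Prod>i<n. ?w i) = (\<Prod>i<n. if i = m * b then d else 1)"
  proof (rule prod.cong[OF refl])
    fix i assume "i \<in> {..<n}"
    then have i: "i \<le> m * b" using n e by simp
    have "i div b = m \<longleftrightarrow> i = m * b"
      using i b div_mult_self_is_m[of b m] div_times_less_eq_dividend[of i b]
      by (auto intro: le_antisym)
    then show "?w i = (if i = m * b then d else 1)" by simp
  qed
  also have "\<dots> = d" using n e by simp
  finally have "(\<Prod>i<n. ?w i) = d" .
  then show ?thesis
  proof (rule that[of ?w "\<lambda>_. 1" "\<lambda>_. 0" ?w])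
    show "\<forall>i. ?w i = fls_monom 1 0 * ?w i" unfolding fls_monom_1_0 by (intro allI mult_1_left[symmetric])
    show "\<forall>i. (1 :: 'a) \<noteq> 0 \<and> ?w i \<noteq> 0" using d by simp
    show "\<forall>i j. i < m * b \<longrightarrow> i div b = j div b \<longrightarrow> ?w i = ?w j"
      by (intro allI impI) (simp only:)
  qed
next
  assume e: "e = 0 \<and> of_nat b \<noteq> (0 :: 'a)"
  obtain c k v where c: "c \<noteq> 0" "v \<noteq> 0" "d = fls_monom c k * v ^ b"
    using fls_monom_times_power_decomposition[OF conjunct2[OF e] d] by metis
  have bn: "b \<le> n" using n e by (cases m) auto
  \<comment> \<open>The first block has b entries, so putting \<open>v\<close> there contributes
    \<open>v ^ b\<close>; the monomial is put in entry 0 alone.\<close>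
  let ?w = "\<lambda>i. if i div b = 0 then v else 1"
  let ?u = "\<lambda>i::nat. if i = 0 then c else 1"
  let ?M = "\<lambda>i::nat. if i = 0 then k else 0"
  have "(\<Prod>i<n. ?w i) = (\<Prod>i<n. if i < b then v else 1)"
    using b by (intro prod.cong) (auto simp: div_eq_0_iff)
  also have "\<dots> = (\<Prod>i<b. v)"
    using bn by (intro prod.mono_neutral_cong_right) auto
  also have "\<dots> = v ^ b" by simp
  finally have 1: "(\<Prod>i<n. ?w i) = v ^ b" .
  have "(\<Prod>i<n. fls_monom (?u i) (?M i)) = (\<Prod>i<n. if i = 0 then fls_monom c k else 1)"
    by (intro prod.cong) (auto simp: fls_monom_1_0)
  also have "\<dots> = fls_monom c k" using n by simp
  finally have 2: "(\<Prod>i<n. fls_monom (?u i) (?M i)) = fls_monom c k" .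
  show ?thesis
  proof (rule that[of "\<lambda>i. fls_monom (?u i) (?M i) * ?w i" ?u ?M ?w])
    show "(\<Prod>i<n. fls_monom (?u i) (?M i) * ?w i) = d" by (simp only: prod.distrib 1 2 c(3))
    show "\<forall>i. ?u i \<noteq> 0 \<and> ?w i \<noteq> 0" using c(1,2) by simp
    show "\<forall>i j. i < m * b \<longrightarrow> i div b = j div b \<longrightarrow> ?w i = ?w j"
      by (intro allI impI) (simp only:)
  qed (rule allI, rule refl)
qed

lemma almost_commuting_representative:
  fixes N :: "'a::alg_closed_field fls mat"
  assumes n: "n \<ge> 2" and sep: "separable_char_poly n N" and q: "q \<noteq> 0"
    and hom: "homogeneous_in_pi_power n q (char_poly N)"
  obtains N' f where "N' \<in> SL_class n N" "algebraic_hom n f" "almost_commutes n f N'"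
proof -
  let ?p = "char_poly N"
  note N = separable_char_polyD(1)[OF sep] and deg = separable_char_polyD(2)[OF sep]
    and monic = separable_char_polyD(3)[OF sep]
  have card: "card {x. eigenvalue (map_mat to_ac N) x} = n"
    using sep unfolding eigenvalue_to_ac_iff[OF N] separable_char_poly_def by simp
  obtain a b c where b: "b > 0" and qab: "q = of_int a / of_nat b"
    and dvd: "\<forall>i\<le>n. c i \<noteq> 0 \<longrightarrow> b dvd i"
    and c: "\<forall>i\<le>n. Polynomial.coeff ?p (n - i) = fls_monom (c i) (a * int (i div b))"
    by (rule homogeneous_coeffsE[OF hom])
  \<comment> \<open>The multiplicity of the root 0, which is at most 1: \<open>c n\<close> is
    nonzero exactly when the constant coefficient is.\<close>
  define e :: nat where "e = (if c n \<noteq> 0 then 0 else 1)"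
  have "Polynomial.coeff ?p 0 = 0 \<longleftrightarrow> c n = 0" "Polynomial.coeff ?p 1 = 0 \<longleftrightarrow> c (n - 1) = 0"
    using c[rule_format, of n] c[rule_format, of "n - 1"] n by auto
  then have "c (n - e) \<noteq> 0" using separable_char_poly_coeff_nonzero[OF sep] by (auto simp: e_def)
  then have "b dvd n - e" using dvd by simp
  then obtain m where "n - e = b * m" by auto
  then have nm: "n = m * b + e" using n by (auto simp: e_def mult.commute split: if_splits)
  have e: "e = 0 \<or> c n = 0" "e \<le> 1" by (auto simp: e_def)
  obtain al where al: "\<forall>x. poly (map_poly to_ac ?p) x = 0 \<longrightarrow> x \<noteq> 0 \<longrightarrow>
      (\<exists>k<m. x ^ b = to_ac (fls_monom (al k) a))"
    by (rule root_power_of_homogeneous[OF b nm e deg monic dvd c])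
  let ?B = "block_mat n b m a al"
  have B: "?B \<in> carrier_mat n n" by simp
  have sub: "{x. eigenvalue (map_mat to_ac N) x} \<subseteq> {x. eigenvalue (map_mat to_ac ?B) x}"
  proof safe
    fix x assume "eigenvalue (map_mat to_ac N) x"
    then have x: "poly (map_poly to_ac ?p) x = 0" by (simp add: eigenvalue_to_ac_iff[OF N])
    show "eigenvalue (map_mat to_ac ?B) x"
    proof (cases "x = 0")
      case True
      then have "Polynomial.coeff ?p 0 = 0" using x by (simp add: poly_0_coeff_0)
      then have "e = 1" using c[rule_format, of n] by (simp add: e_def)
      then show ?thesis using block_mat_eigenvalue_0[OF b, of m n] nm True by simp
    next
      case False
      then obtain k where k: "k < m" "x ^ b = to_ac (fls_monom (al k) a)" using al x by blast
      have "m * b \<le> n" using nm by simp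
      then show ?thesis using k by (intro block_mat_eigenvalue[OF b])
    qed
  qed
  have Bp: "Polynomial.degree (map_poly to_ac (char_poly ?B)) = n" "map_poly to_ac (char_poly ?B) \<noteq> 0"
    using degree_monic_char_poly[OF B] n by auto
  \<comment> \<open>The block matrix has at most n eigenvalues and already contains the n
    eigenvalues of \<open>N\<close>, so the inclusion is an equality.\<close>
  have "finite {x. eigenvalue (map_mat to_ac ?B) x}" "card {x. eigenvalue (map_mat to_ac ?B) x} \<le> n"
    unfolding eigenvalue_to_ac_iff[OF B]
    using poly_roots_finite[OF Bp(2)] card_poly_roots_bound[OF Bp(2)] Bp(1) by auto
  then have same: "{x. eigenvalue (map_mat to_ac N) x} = {x. eigenvalue (map_mat to_ac ?B) x}"
    using card_seteq[OF _ sub] card by simp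
  obtain g where g: "g \<in> carrier_mat n n" "det g \<noteq> 0" "N * g = g * ?B"
    by (rule conjugate_if_same_eigenvalues[OF infinite_UNIV_fls N B same card])
  have ee: "e = 1 \<or> e = 0 \<and> of_nat b \<noteq> (0 :: 'a)"
  proof -
    have "of_nat b \<noteq> (0 :: 'a)" if "e = 0"
    proof (rule char_not_dvd_if_separable[OF sep])
      show "n > 0" using n by simp
      show "b dvd n" using nm that by simp
      show "\<forall>i\<le>n. Polynomial.coeff ?p (n - i) \<noteq> 0 \<longrightarrow> b dvd i" using c dvd by simp
    qed
    then show ?thesis using e by auto
  qed
  obtain h w u M where det: "(\<Prod>i<n. h i) = det g" and h: "\<forall>i. h i = fls_monom (u i) (M i) * w i"
    and uw: "\<forall>i. u i \<noteq> 0 \<and> w i \<noteq> 0" and w: "\<forall>i j. i < m * b \<longrightarrow> i div b = j div b \<longrightarrow> w i = w j"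
    by (rule diagonal_with_det[OF g(2) nm _ b ee]) (use n in auto)
  have h0: "h i \<noteq> 0" for i using h uw by simp
  let ?H = "mat_diag n h" and ?H' = "mat_diag n (\<lambda>i. inverse (h i))"
  have H1: "?H * 1\<^sub>m n = ?H" by (rule right_mult_one_mat[of _ n n]) simp
  have HH: "?H * ?H' = 1\<^sub>m n" using h0 by simp
  have "g \<in> Units (ring_mat TYPE('a fls) n ())" by (rule det_non_zero_imp_unit[OF g(1,2)])
  then obtain g' where g': "g' \<in> carrier_mat n n" "g * g' = 1\<^sub>m n" "g' * g = 1\<^sub>m n"
    by (auto simp: Units_def ring_mat_def)
  \<comment> \<open>With \<open>g'\<close> the inverse of \<open>g\<close>, conjugation by
    \<open>g'\<close> gives the block matrix, and \<open>?H\<close> brings the determinant back to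
    1.\<close>
  define G where "G = ?H * g'"
  have G: "G \<in> carrier_mat n n" unfolding G_def using g'(1) by (intro mult_carrier_mat[of _ _ n]) auto
  have "det g * det g' = 1" using det_mult[OF g(1) g'(1)] g'(2) by simp
  then have "det G = 1"
    unfolding G_def by (subst det_mult[of _ n]) (use g'(1) det in \<open>auto simp: det_mat_diag\<close>)
  then have GSL: "G \<in> SL n" using G by (simp add: SL_def)
  have gH': "g * ?H' \<in> carrier_mat n n" using g(1) by (intro mult_carrier_mat[of _ _ n]) auto
  have "G * (g * ?H') = ?H * (g' * g) * ?H'"
    unfolding G_def using g(1) g'(1) by (simp add: assoc_mult_mat[of _ n n _ n _ n])
  also have "\<dots> = 1\<^sub>m n" by (simp only: g'(3) H1 HH)
  finally have "(g * ?H') * G = 1\<^sub>m n" using mat_mult_left_right_inverse[OF G gH'] by simp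
  then have Ginv: "inv\<^bsub>GL n\<^esub> G = g * ?H'" by (rule GL_inv_eqI(2)[OF G gH'])
  define N' where "N' = ?H * ?B * ?H'"
  have "G * N * inv\<^bsub>GL n\<^esub> G = ?H * g' * (N * g) * ?H'"
    unfolding Ginv unfolding G_def using g(1) g'(1) N
    by (simp add: assoc_mult_mat[of _ n n _ n _ n])
  also have "\<dots> = ?H * (g' * g) * ?B * ?H'"
    unfolding g(3) using g(1) g'(1) by (simp add: assoc_mult_mat[of _ n n _ n _ n])
  also have "\<dots> = N'" by (simp only: N'_def g'(3) H1)
  finally have "G * N * inv\<^bsub>GL n\<^esub> G = N'" .
  then have "N' \<in> SL_class n N" unfolding SL_class_def using GSL by auto
  \<comment> \<open>The weights \<open>- a * (i mod b)\<close> grade the block matrix. Conjugation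
    by \<open>?H\<close> shifts the exponent of entry (i, j) by \<open>M i - M j\<close>, which the
    terms \<open>- b * M i\<close> compensate, so the total weight remains a.\<close>
  moreover have "algebraic_hom n (Qprime_cochar n (\<lambda>i. - a * int (i mod b) - int b * M i) (int b) :: 'a \<Rightarrow> _)"
    by (rule algebraic_hom_Qprime_cochar)
  moreover have "almost_commutes n (Qprime_cochar n (\<lambda>i. - a * int (i mod b) - int b * M i) (int b)) N'"
  proof (rule graded_almost_commutes)
    have N'_eq: "N' = Matrix.mat n n (\<lambda>(i, j). h i * ?B $$ (i, j) * inverse (h j))"
      unfolding N'_def mat_diag_mult_left[OF B]
      by (subst mat_diag_mult_right[of _ n]) (auto intro!: eq_matI)
    then show "N' \<in> carrier_mat n n" by simp
    show "a \<noteq> 0" using q qab by auto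
    fix i j assume ij: "i < n" "j < n" and nz: "N' $$ (i, j) \<noteq> 0"
    have N'ij: "N' $$ (i, j) = h i * ?B $$ (i, j) * inverse (h j)" using ij by (simp add: N'_eq)
    then have "?B $$ (i, j) \<noteq> 0" using nz by auto
    then obtain x k where x: "?B $$ (i, j) = fls_monom x k"
      and k: "int b * k - a * int (i mod b) + a * int (j mod b) = a" and "i < m * b" "i div b = j div b"
      using block_mat_nonzeroE[OF ij _ b] by metis
    \<comment> \<open>A nonzero entry joins two indices of one block, so the factors
      \<open>w i\<close> and \<open>inverse (w j)\<close> cancel and the entry remains a
      monomial.\<close>
    then have wij: "w i = w j" using w by blast
    have inv: "inverse (h j) = fls_monom (inverse (u j)) (- M j) * inverse (w j)"
      using h uw by (simp add: inverse_fls_monom)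
    have "N' $$ (i, j) = (fls_monom (u i) (M i) * fls_monom x k * fls_monom (inverse (u j)) (- M j)) *
        (w j * inverse (w j))"
      unfolding N'ij x inv by (simp only: h[rule_format, of i] wij mult_ac)
    also have "\<dots> = fls_monom (u i * x * inverse (u j)) (M i + k - M j)"
      using uw by (simp add: fls_monom_mult)
    finally show "\<exists>c l. N' $$ (i, j) = fls_monom c l \<and>
        int b * l + (- a * int (i mod b) - int b * M i) - (- a * int (j mod b) - int b * M j) = a"
      using k by (intro exI[of _ "u i * x * inverse (u j)"] exI[of _ "M i + k - M j"])
        (simp add: algebra_simps)
  qed
  ultimately show ?thesis by (rule that)
qed

section \<open>Passage to conjugacy classes\<close>

lemma SL_class_refl:
  fixes N :: "'a::field mat"
  assumes N: "N \<in> carrier_mat n n"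
  shows "N \<in> SL_class n N"
proof -
  have "(1\<^sub>m n :: 'a mat) \<in> SL n" by (simp add: SL_def)
  moreover have "inv\<^bsub>GL n\<^esub> (1\<^sub>m n :: 'a mat) = 1\<^sub>m n" by (rule GL_inv_eqI) auto
  ultimately show ?thesis
    unfolding SL_class_def using N by (auto intro!: exI[of _ "1\<^sub>m n"])
qed

lemma SL_class_similar:
  fixes N :: "'a::field fls mat"
  assumes N: "N \<in> carrier_mat n n" and M: "M \<in> SL_class n N"
  shows "M \<in> carrier_mat n n" "char_poly M = char_poly N"
proof -
  show "char_poly M = char_poly N"
    using class_char_poly_SL_class[OF N] SL_class_refl[OF N] M by metis
  obtain g where g: "g \<in> SL n" "M = g * N * inv\<^bsub>GL n\<^esub> g" using M by (auto simp: SL_class_def)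
  have "g \<in> carrier (GL n)" using g(1) SL_subset_GL by blast
  from GL_inv(2)[OF this] show "M \<in> carrier_mat n n" using N g by (auto simp: SL_def)
qed

lemma separable_if_regular_semisimple:
  assumes "regular_semisimple n N"
  shows "separable_char_poly n N"
proof -
  have N: "N \<in> carrier_mat n n" using assms by (simp add: regular_semisimple_def sl_def)
  then show ?thesis
    using assms unfolding separable_char_poly_def regular_semisimple_def eigenvalue_to_ac_iff[OF N] by simp
qed

lemma almost_commuting_iff_homogeneous:
  fixes N :: "'a::alg_closed_field fls mat"
  assumes n: "n \<ge> 2" and reg: "regular_semisimple n N"
  shows "(\<exists>M\<in>SL_class n N. \<exists>f. algebraic_hom n f \<and> almost_commutes n f M) \<longleftrightarrow>
    (\<exists>q :: rat. q \<noteq> 0 \<and>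
      ((\<exists>a :: int. q = of_int a / of_nat (n - 1)) \<or> (\<exists>a :: int. q = of_int a / of_nat n)) \<and>
      homogeneous_in_pi_power n q (char_poly N))" (is "?l \<longleftrightarrow> ?r")
proof
  note sep = separable_if_regular_semisimple[OF reg]
  note N = separable_char_polyD(1)[OF sep]
  {
    assume ?l
    then obtain M f where M: "M \<in> SL_class n N" and f: "algebraic_hom n f" "almost_commutes n f M"
      by blast
    note sim = SL_class_similar[OF N M]
    have "separable_char_poly n M" using sep sim by (simp add: separable_char_poly_def)
    from homogeneous_if_almost_commutes[OF n this f] show ?r unfolding sim(2) by metis
  next
    assume ?r
    then obtain q :: rat where "q \<noteq> 0" "homogeneous_in_pi_power n q (char_poly N)" by blast
    from almost_commuting_representative[OF n sep this] show ?l by metis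
  }
qed

theorem theorem3p3:
  fixes n :: nat and C :: "'a::alg_closed_field fls mat set"
  assumes "n \<ge> 2"
  shows
    "(regular_semisimple_class n C \<longrightarrow>
       ((\<exists>N\<in>C. \<exists>f. algebraic_hom n f \<and> almost_commutes n f N) \<longleftrightarrow>
        (\<exists>q :: rat. q \<noteq> 0 \<and>
           ((\<exists>a :: int. q = of_int a / of_nat (n - 1)) \<or> (\<exists>a :: int. q = of_int a / of_nat n)) \<and>
           homogeneous_in_pi_power n q (class_char_poly C)))) \<and>
     (nil_regular_semisimple_class n C \<longrightarrow>
       ((\<exists>N\<in>C. \<exists>f. algebraic_hom n f \<and> almost_commutes n f N) \<longleftrightarrow>
        (\<exists>q :: rat. q > 0 \<and>
           ((\<exists>a :: int. q = of_int a / of_nat (n - 1)) \<or> (\<exists>a :: int. q = of_int a / of_nat n)) \<and>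
           homogeneous_in_pi_power n q (class_char_poly C))))"
proof (intro conjI impI)
  have class_char_poly: "class_char_poly (SL_class n N) = char_poly N" if "regular_semisimple n N"
    for N :: "'a fls mat"
  proof -
    have N: "N \<in> carrier_mat n n" using that by (simp add: regular_semisimple_def sl_def)
    have "N \<in> SL_class n N" by (rule SL_class_refl[OF N])
    then show ?thesis by (rule class_char_poly_SL_class[OF N])
  qed
  {
    assume "regular_semisimple_class n C"
    then obtain N where N: "regular_semisimple n N" "C = SL_class n N"
      by (auto simp: regular_semisimple_class_def)
    show "(\<exists>N\<in>C. \<exists>f. algebraic_hom n f \<and> almost_commutes n f N) \<longleftrightarrow>
        (\<exists>q :: rat. q \<noteq> 0 \<and>
           ((\<exists>a :: int. q = of_int a / of_nat (n - 1)) \<or> (\<exists>a :: int. q = of_int a / of_nat n)) \<and>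
           homogeneous_in_pi_power n q (class_char_poly C))"
      unfolding N(2) class_char_poly[OF N(1)] by (rule almost_commuting_iff_homogeneous[OF assms N(1)])
  next
    assume "nil_regular_semisimple_class n C"
    then obtain N where N: "regular_semisimple n N" "nil_elt n N" "C = SL_class n N"
      by (auto simp: nil_regular_semisimple_class_def)
    note sep = separable_if_regular_semisimple[OF N(1)]
    \<comment> \<open>The conjugate with power series entries has a characteristic polynomial
      without negative powers of \<pi>. As this is the polynomial of the class, every admissible
      nonzero q is positive.\<close>
    obtain N' where N': "N' \<in> sl n" "map_mat fps_to_fls N' \<in> SL_class n N"
      using N(2) by (auto simp: nil_elt_def)
    have "char_poly N = char_poly (map_mat fps_to_fls N')"
      using SL_class_similar(2)[OF separable_char_polyD(1)[OF sep] N'(2)] by simp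
    moreover have "N' \<in> carrier_mat n n" using N'(1) by (simp add: sl_def)
    ultimately have "fls_nth (Polynomial.coeff (char_poly N) k) m = 0" if "m < 0" for k m
      using coeff_char_poly_integral that by metis
    then have pos: "q > 0" if "q \<noteq> 0" "homogeneous_in_pi_power n q (char_poly N)" for q
      using nonneg_exponent_if_integral[OF assms sep that(2)] that(1) by force
    show "(\<exists>N\<in>C. \<exists>f. algebraic_hom n f \<and> almost_commutes n f N) \<longleftrightarrow>
        (\<exists>q :: rat. q > 0 \<and>
           ((\<exists>a :: int. q = of_int a / of_nat (n - 1)) \<or> (\<exists>a :: int. q = of_int a / of_nat n)) \<and>
           homogeneous_in_pi_power n q (class_char_poly C))"
      unfolding N(3) class_char_poly[OF N(1)] almost_commuting_iff_homogeneous[OF assms N(1)]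
      using pos by (metis less_irrefl)
  }
qed

end
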